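(* For every constant $k$, the problem of listing the maximal induced $k$-degenerate subgraphs of a graph $G$ is proximity searchable, and these subgraphs can be enumerated (each exactly once) with $O(mn^{k+2})$ time delay.
   Context: $G$ is a simple undirected graph with $n$ vertices and $m$ edges (isolated vertices disregarded in the complexity analysis). A graph is $k$-degenerate if every subgraph has a vertex of degree at most $k$. A maximal induced $k$-degenerate subgraph is an inclusion-maximal $S\subseteq V(G)$ with $G[S]$ $k$-degenerate. A listing problem with universe $\mathcal{U}$ (here $V(G)$) and set $\mathcal{S}$ of solutions to list is proximity searchable if there exist $\tilde{\cap}:\mathcal{S}\times\mathcal{S}\to 2^{\mathcal{U}}$ and $\mathrm{neighbors}:\mathcal{S}\to 2^{\mathcal{S}}$ such that one solution can be found in time polynomial in $|\mathcal{U}|$, $\mathrm{neighbors}$ is computable in time polynomial in $|\mathcal{U}|$, and for any two distinct $S,S^*\in\mathcal{S}$ some $S'\in\mathrm{neighbors}(S)$ satisfies $|S'\,\tilde{\cap}\,S^*|>|S\,\tilde{\cap}\,S^*|$. Delay is the maximum time before the first output, between consecutive outputs, and after the last output. *)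

theory Defs
  imports "HOL-Computational_Algebra.Polynomial"
begin

section \<open>Degenerate subgraphs\<close>

text \<open>A graph is a pair of a vertex set and a set of edges, each edge being a two-element set of
  vertices.\<close>

type_synonym 'a graph = "'a set \<times> 'a set set"

definition simple_graph :: "'a graph \<Rightarrow> bool" where
  "simple_graph G \<longleftrightarrow> finite (fst G) \<and> (\<forall>e\<in>snd G. e \<subseteq> fst G \<and> card e = 2)"

definition subgraph :: "'a graph \<Rightarrow> 'a graph \<Rightarrow> bool" where
  "subgraph H G \<longleftrightarrow> simple_graph H \<and> fst H \<subseteq> fst G \<and> snd H \<subseteq> snd G"

definition induced :: "'a graph \<Rightarrow> 'a set \<Rightarrow> 'a graph" where
  "induced G S = (S, {e \<in> snd G. e \<subseteq> S})"

definition vertex_degree :: "'a graph \<Rightarrow> 'a \<Rightarrow> nat" where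
  "vertex_degree G v = card {e \<in> snd G. v \<in> e}"

text \<open>The subgraph without vertices has to be excluded.\<close>

definition degenerate :: "nat \<Rightarrow> 'a graph \<Rightarrow> bool" where
  "degenerate k G \<longleftrightarrow>
     (\<forall>H. subgraph H G \<and> fst H \<noteq> {} \<longrightarrow> (\<exists>v\<in>fst H. vertex_degree H v \<le> k))"

definition maximal_degenerate :: "nat \<Rightarrow> 'a graph \<Rightarrow> 'a set set" where
  "maximal_degenerate k G =
     {S. S \<subseteq> fst G \<and> degenerate k (induced G S) \<and>
         (\<forall>T. S \<subset> T \<and> T \<subseteq> fst G \<longrightarrow> \<not> degenerate k (induced G T))}"


section \<open>Machine model\<close>

text \<open>
  Running times refer to the random access machine with uniform cost, presented as a structured
  imperative language. A state has registers and unbounded arrays of natural numbers. A program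
  mentions finitely many registers and arrays, so the arrays can be interleaved in a single memory
  with constant overhead. The arithmetic is addition and truncated subtraction. Multiplication is
  left out on purpose: at unit cost it would make polynomial time too powerful.
\<close>

type_synonym state = "(nat \<Rightarrow> nat) \<times> (nat \<Rightarrow> nat \<Rightarrow> nat)"

datatype aexp = Num nat | Reg nat | Get nat aexp | Plus aexp aexp | Minus aexp aexp

datatype bexp = Less aexp aexp | Eq aexp aexp | Not bexp | And bexp bexp

fun aval :: "aexp \<Rightarrow> state \<Rightarrow> nat" where
  "aval (Num n) s = n"
| "aval (Reg x) s = fst s x"
| "aval (Get A a) s = snd s A (aval a s)"
| "aval (Plus a b) s = aval a s + aval b s"
| "aval (Minus a b) s = aval a s - aval b s"

fun bval :: "bexp \<Rightarrow> state \<Rightarrow> bool" where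
  "bval (Less a b) s \<longleftrightarrow> aval a s < aval b s"
| "bval (Eq a b) s \<longleftrightarrow> aval a s = aval b s"
| "bval (Not b) s \<longleftrightarrow> \<not> bval b s"
| "bval (And b c) s \<longleftrightarrow> bval b s \<and> bval c s"

fun acost :: "aexp \<Rightarrow> nat" where
  "acost (Num n) = 1"
| "acost (Reg x) = 1"
| "acost (Get A a) = 1 + acost a"
| "acost (Plus a b) = 1 + acost a + acost b"
| "acost (Minus a b) = 1 + acost a + acost b"

fun bcost :: "bexp \<Rightarrow> nat" where
  "bcost (Less a b) = 1 + acost a + acost b"
| "bcost (Eq a b) = 1 + acost a + acost b"
| "bcost (Not b) = 1 + bcost b"
| "bcost (And b c) = 1 + bcost b + bcost c"

text \<open>
  A set is output one element at a time: \<open>Put\<close> adds an element to the set under construction, and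
  \<open>Emit\<close> completes the output of that set and starts afresh with the empty set.
\<close>

datatype com =
    Skip
  | Assign nat aexp
  | Store nat aexp aexp
  | Seq com com
  | If bexp com com
  | While bexp com
  | Put aexp
  | Emit

text \<open>The trace of a run has one event per unit of time, so that its length is the running time.\<close>

datatype event = Step | Elem nat | Output

abbreviation steps :: "nat \<Rightarrow> event list" where
  "steps t \<equiv> replicate t Step"

inductive exec :: "com \<Rightarrow> state \<Rightarrow> event list \<Rightarrow> state \<Rightarrow> bool" where
  Skip: "exec Skip s [Step] s"
| Assign: "exec (Assign x a) s (steps (acost a + 1)) ((fst s)(x := aval a s), snd s)"
| Store: "exec (Store A a b) s (steps (acost a + acost b + 1))
            (fst s, (snd s)(A := (snd s A)(aval a s := aval b s)))"
| Seq: "exec c s tr s' \<Longrightarrow> exec d s' tr' s'' \<Longrightarrow> exec (Seq c d) s (tr @ tr') s''"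
| IfTrue: "bval b s \<Longrightarrow> exec c s tr s' \<Longrightarrow> exec (If b c d) s (steps (bcost b) @ tr) s'"
| IfFalse: "\<not> bval b s \<Longrightarrow> exec d s tr s' \<Longrightarrow> exec (If b c d) s (steps (bcost b) @ tr) s'"
| WhileFalse: "\<not> bval b s \<Longrightarrow> exec (While b c) s (steps (bcost b)) s"
| WhileTrue: "bval b s \<Longrightarrow> exec c s tr s' \<Longrightarrow> exec (While b c) s' tr' s'' \<Longrightarrow>
    exec (While b c) s (steps (bcost b) @ tr @ tr') s''"
| Put: "exec (Put a) s (steps (acost a) @ [Elem (aval a s)]) s"
| Emit: "exec Emit s [Output] s"

fun outputs_from :: "nat set \<Rightarrow> event list \<Rightarrow> nat set list" where
  "outputs_from A [] = []"
| "outputs_from A (Step # tr) = outputs_from A tr"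
| "outputs_from A (Elem v # tr) = outputs_from (insert v A) tr"
| "outputs_from A (Output # tr) = A # outputs_from {} tr"

definition outputs :: "event list \<Rightarrow> nat set list" where
  "outputs tr = outputs_from {} tr"

text \<open>
  The lengths of the periods before the first output, between consecutive outputs and after the last
  output. The time spent on writing an output belongs to the period that ends with it.
\<close>

fun gaps_from :: "nat \<Rightarrow> event list \<Rightarrow> nat list" where
  "gaps_from t [] = [t]"
| "gaps_from t (Output # tr) = (t + 1) # gaps_from 0 tr"
| "gaps_from t (Step # tr) = gaps_from (t + 1) tr"
| "gaps_from t (Elem v # tr) = gaps_from (t + 1) tr"

definition delay :: "event list \<Rightarrow> nat" where
  "delay tr = Max (set (gaps_from 0 tr))"

text \<open>The \<open>i\<close>-th input is placed in the \<open>i\<close>-th array. Everything else is initially zero.\<close>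

definition load :: "nat list list \<Rightarrow> state" where
  "load xss = (\<lambda>_. 0, \<lambda>i j. if i < length xss \<and> j < length (xss ! i) then xss ! i ! j else 0)"


section \<open>Encodings of the inputs\<close>

text \<open>
  The vertices of an input graph are \<open>0, \<dots>, n - 1\<close>. The input consists of \<open>n\<close>, \<open>m\<close> and the end
  points of the \<open>m\<close> edges, which are listed once each, in any order and orientation.
\<close>

definition graph_code :: "nat graph \<Rightarrow> nat list \<Rightarrow> bool" where
  "graph_code G xs \<longleftrightarrow> simple_graph G \<and> fst G = {..<card (fst G)} \<and>
     (\<exists>es. length es = card (snd G) \<and> (\<lambda>(u, v). {u, v}) ` set es = snd G \<and>
           xs = card (fst G) # card (snd G) # concat (map (\<lambda>(u, v). [u, v]) es))"

definition set_code :: "nat set \<Rightarrow> nat list \<Rightarrow> bool" where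
  "set_code S ys \<longleftrightarrow> (\<exists>vs. distinct vs \<and> set vs = S \<and> ys = length vs # vs)"


section \<open>Proximity searchable problems\<close>

text \<open>
  A listing problem is given by the codes \<open>code I\<close> of the instances \<open>I\<close> (objects without a code are
  not instances), their universes \<open>U I\<close> and their sets of solutions \<open>Sol I\<close>. The programs and the
  polynomials that bound their running times are the same for all instances.
\<close>

definition proximity_searchable ::
  "('i \<Rightarrow> nat list \<Rightarrow> bool) \<Rightarrow> ('i \<Rightarrow> nat set) \<Rightarrow> ('i \<Rightarrow> nat set set) \<Rightarrow> bool" where
  "proximity_searchable code U Sol \<longleftrightarrow>
    (\<exists>(cap :: 'i \<Rightarrow> nat set \<Rightarrow> nat set \<Rightarrow> nat set) (neighbors :: 'i \<Rightarrow> nat set \<Rightarrow> nat set set).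
      (\<forall>I xs. code I xs \<longrightarrow>
        (\<forall>S\<in>Sol I. \<forall>S'\<in>Sol I. cap I S S' \<subseteq> U I) \<and>
        (\<forall>S\<in>Sol I. neighbors I S \<subseteq> Sol I)) \<and>
      (\<exists>P p. \<forall>I xs. code I xs \<longrightarrow>
        (\<exists>tr s. exec P (load [xs]) tr s \<and> length tr \<le> poly p (card (U I)) \<and>
                (\<exists>S\<in>Sol I. outputs tr = [S]))) \<and>
      (\<exists>P p. \<forall>I xs S ys. code I xs \<and> S \<in> Sol I \<and> set_code S ys \<longrightarrow>
        (\<exists>tr s. exec P (load [xs, ys]) tr s \<and> length tr \<le> poly p (card (U I)) \<and>
                set (outputs tr) = neighbors I S)) \<and>
      (\<forall>I xs. code I xs \<longrightarrow>
        (\<forall>S\<in>Sol I. \<forall>S'\<in>Sol I. S \<noteq> S' \<longrightarrow>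
          (\<exists>T\<in>neighbors I S. card (cap I T S') > card (cap I S S')))))"

end

theory Submission
  imports Defs "HOL-Library.Nat_Bijection"
begin

text \<open>
  Fix for every solution \<open>S'\<close> an order in which each vertex has at most \<open>k\<close> earlier neighbours, and
  let the proximity of \<open>S\<close> to \<open>S'\<close> be the longest prefix of that order inside \<open>S\<close>. If \<open>v\<close> is the
  first vertex of \<open>S'\<close> outside \<open>S\<close>, then adding \<open>v\<close> to \<open>S\<close> and deleting all neighbours of \<open>v\<close> except
  the at most \<open>k\<close> of them in the prefix keeps the set degenerate, and any completion of it to a
  solution contains a longer prefix. Guessing the retained neighbours gives \<open>2 m n ^ (k - 1)\<close>
  candidates for \<open>k > 0\<close>, since \<open>v\<close> and one of its neighbours form an edge, and each of them is
  completed greedily in time \<open>n ^ 3\<close>. For \<open>k = 0\<close> there are \<open>2 m\<close> candidates, and a completion takes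
  time \<open>n ^ 2\<close>.

  A set is identified with the number whose binary digits are its characteristic function, which
  additions compute in linear time and which then serves as an array index. So the solution graph
  can be searched breadth first, with one output per solution taken from the queue.
\<close>

section \<open>Programs with bounded loops\<close>

text \<open>Correctness and cost are kept apart. A loop bounded by a cell of the input array makes
  the effect of a program a total function and its cost a static bound in that array alone. Only the
  search over the queue is unbounded; it ends because the queue holds distinct solutions, of which
  there are finitely many. Degeneracy is hereditary, and most steps rest on this: a vertex refused
  by the greedy completion stays refused, one pass yields a maximal set, and the order of peeling is
  immaterial. The proximity itself is never computed. Programs generate all guesses blindly, and
  every guess yields a solution, so the orders behind the proximity may be chosen without an
  algorithm. A round of the search may enqueue many solutions but outputs exactly one, and it
  outputs before it generates.\<close>

datatype prog =
    PSkip
  | PAssign nat aexp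
  | PStore nat aexp aexp
  | PSeq prog prog (infixr \<open>;;\<close> 60)
  | PIf bexp prog prog
  | PFor nat nat prog
  | PPut aexp
  | PEmit

abbreviation setr :: "nat \<Rightarrow> nat \<Rightarrow> state \<Rightarrow> state" where
  "setr x a s \<equiv> ((fst s)(x := a), snd s)"

primrec compile :: "prog \<Rightarrow> com" where
  "compile PSkip = Skip"
| "compile (PAssign x a) = Assign x a"
| "compile (PStore A a b) = Store A a b"
| "compile (p ;; q) = Seq (compile p) (compile q)"
| "compile (PIf b p q) = If b (compile p) (compile q)"
| "compile (PFor x j p) = Seq (Assign x (Num 0)) (While (Less (Reg x) (Get 0 (Num j)))
      (Seq (compile p) (Assign x (Plus (Reg x) (Num 1)))))"
| "compile (PPut a) = Put a"
| "compile PEmit = Emit"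

primrec wregs :: "prog \<Rightarrow> nat set" where
  "wregs PSkip = {}"
| "wregs (PAssign x a) = {x}"
| "wregs (PStore A a b) = {}"
| "wregs (p ;; q) = wregs p \<union> wregs q"
| "wregs (PIf b p q) = wregs p \<union> wregs q"
| "wregs (PFor x j p) = insert x (wregs p)"
| "wregs (PPut a) = {}"
| "wregs PEmit = {}"

primrec warrs :: "prog \<Rightarrow> nat set" where
  "warrs PSkip = {}"
| "warrs (PAssign x a) = {}"
| "warrs (PStore A a b) = {A}"
| "warrs (p ;; q) = warrs p \<union> warrs q"
| "warrs (PIf b p q) = warrs p \<union> warrs q"
| "warrs (PFor x j p) = warrs p"
| "warrs (PPut a) = {}"
| "warrs PEmit = {}"

text \<open>The bound of a loop is a cell of the input array 0, which no program may overwrite.\<close>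

primrec wf_prog :: "prog \<Rightarrow> bool" where
  "wf_prog PSkip \<longleftrightarrow> True"
| "wf_prog (PAssign x a) \<longleftrightarrow> True"
| "wf_prog (PStore A a b) \<longleftrightarrow> A \<noteq> 0"
| "wf_prog (p ;; q) \<longleftrightarrow> wf_prog p \<and> wf_prog q"
| "wf_prog (PIf b p q) \<longleftrightarrow> wf_prog p \<and> wf_prog q"
| "wf_prog (PFor x j p) \<longleftrightarrow> wf_prog p \<and> x \<notin> wregs p"
| "wf_prog (PPut a) \<longleftrightarrow> True"
| "wf_prog PEmit \<longleftrightarrow> True"

text \<open>For a loop, 8 is one test (4) plus one increment (4), and 6 is the initialisation (2)
  plus the failing test (4). Both branches of a conditional are charged, so that the bound depends
  on the input array \<open>f\<close> alone and not on the state reached.\<close>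

primrec time :: "(nat \<Rightarrow> nat) \<Rightarrow> prog \<Rightarrow> nat" where
  "time f PSkip = 1"
| "time f (PAssign x a) = acost a + 1"
| "time f (PStore A a b) = acost a + acost b + 1"
| "time f (p ;; q) = time f p + time f q"
| "time f (PIf b p q) = bcost b + time f p + time f q"
| "time f (PFor x j p) = f j * (time f p + 8) + 6"
| "time f (PPut a) = acost a + 1"
| "time f PEmit = 1"

text \<open>The counter is set to \<open>i\<close> in each round, whereas the compiled loop
  increments it; the two agree because \<open>wf_prog\<close> forbids the body to write the
  counter.\<close>

primrec eff :: "prog \<Rightarrow> state \<Rightarrow> state" where
  "eff PSkip s = s"
| "eff (PAssign x a) s = setr x (aval a s) s"
| "eff (PStore A a b) s = (fst s, (snd s)(A := (snd s A)(aval a s := aval b s)))"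
| "eff (p ;; q) s = eff q (eff p s)"
| "eff (PIf b p q) s = (if bval b s then eff p s else eff q s)"
| "eff (PFor x j p) s =
    setr x (snd s 0 j) (fold (\<lambda>i t. eff p (setr x i t)) [0..<snd s 0 j] s)"
| "eff (PPut a) s = s"
| "eff PEmit s = s"

primrec loop_outs ::
  "(nat \<Rightarrow> state \<Rightarrow> event list) \<Rightarrow> (nat \<Rightarrow> state \<Rightarrow> state) \<Rightarrow> nat list \<Rightarrow> state \<Rightarrow> event list" where
  "loop_outs f g [] s = []"
| "loop_outs f g (i # is) s = f i s @ loop_outs f g is (g i s)"

primrec outs :: "prog \<Rightarrow> state \<Rightarrow> event list" where
  "outs PSkip s = []"
| "outs (PAssign x a) s = []"
| "outs (PStore A a b) s = []"
| "outs (p ;; q) s = outs p s @ outs q (eff p s)"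
| "outs (PIf b p q) s = (if bval b s then outs p s else outs q s)"
| "outs (PFor x j p) s =
    loop_outs (\<lambda>i t. outs p (setr x i t)) (\<lambda>i t. eff p (setr x i t)) [0..<snd s 0 j] s"
| "outs (PPut a) s = [Elem (aval a s)]"
| "outs PEmit s = [Output]"

primrec silent :: "prog \<Rightarrow> bool" where
  "silent PSkip \<longleftrightarrow> True"
| "silent (PAssign x a) \<longleftrightarrow> True"
| "silent (PStore A a b) \<longleftrightarrow> True"
| "silent (p ;; q) \<longleftrightarrow> silent p \<and> silent q"
| "silent (PIf b p q) \<longleftrightarrow> silent p \<and> silent q"
| "silent (PFor x j p) \<longleftrightarrow> silent p"
| "silent (PPut a) \<longleftrightarrow> False"
| "silent PEmit \<longleftrightarrow> False"

lemma loop_outs_Nil: "(\<And>i t. f i t = []) \<Longrightarrow> loop_outs f g is s = []"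
  by (induction "is" arbitrary: s) auto

lemma outs_silent: "silent p \<Longrightarrow> outs p s = []"
  by (induction p arbitrary: s) (auto intro: loop_outs_Nil)

lemma fst_eff: "y \<notin> wregs p \<Longrightarrow> fst (eff p s) y = fst s y"
proof (induction p arbitrary: s)
  case (PFor x j p)
  have "fst (fold (\<lambda>i t. eff p (setr x i t)) is t) y = fst t y" for "is" t
    using PFor by (induction "is" arbitrary: t) auto
  then show ?case using PFor.prems by auto
qed auto

lemma snd_eff: "A \<notin> warrs p \<Longrightarrow> snd (eff p s) A = snd s A"
proof (induction p arbitrary: s)
  case (PFor x j p)
  have "snd (fold (\<lambda>i t. eff p (setr x i t)) is t) A = snd t A" for "is" t
    using PFor by (induction "is" arbitrary: t) auto
  then show ?case by auto
qed auto

lemma wf_warrs: "wf_prog p \<Longrightarrow> 0 \<notin> warrs p"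
  by (induction p) auto

lemma eff_input: "wf_prog p \<Longrightarrow> snd (eff p s) 0 = snd s 0"
  by (simp add: snd_eff wf_warrs)

abbreviation nonstep :: "event list \<Rightarrow> event list" where
  "nonstep \<equiv> filter (\<lambda>e. e \<noteq> Step)"

text \<open>The bridge to the machine, after which bounded programs are handled through
  \<open>eff\<close>, \<open>outs\<close> and \<open>time\<close>. The times of consecutive parts
  add up because array 0, on which \<open>time\<close> depends, is never overwritten.\<close>

lemma exec_compile:
  "wf_prog p \<Longrightarrow> \<exists>tr. exec (compile p) s tr (eff p s) \<and> length tr \<le> time (snd s 0) p \<and>
     nonstep tr = outs p s"
proof (induction p arbitrary: s)
  case (PSeq p q)
  obtain tr where 1: "exec (compile p) s tr (eff p s)" "length tr \<le> time (snd s 0) p"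
    "nonstep tr = outs p s" using PSeq by fastforce
  obtain tr' where 2: "exec (compile q) (eff p s) tr' (eff q (eff p s))"
    "length tr' \<le> time (snd s 0) q" "nonstep tr' = outs q (eff p s)"
    using PSeq by (metis eff_input wf_prog.simps(4))
  show ?case
    by (rule exI[of _ "tr @ tr'"]) (use 1 2 exec.Seq in auto)
next
  case (PIf b p q)
  obtain tr where 1: "exec (compile p) s tr (eff p s)" "length tr \<le> time (snd s 0) p"
    "nonstep tr = outs p s" using PIf by fastforce
  obtain tr' where 2: "exec (compile q) s tr' (eff q s)"
    "length tr' \<le> time (snd s 0) q" "nonstep tr' = outs q s"
    using PIf by fastforce
  show ?case
  proof (cases "bval b s")
    case True
    then show ?thesis
      by (intro exI[of _ "steps (bcost b) @ tr"]) (use 1 exec.IfTrue in auto)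
  next
    case False
    then show ?thesis
      by (intro exI[of _ "steps (bcost b) @ tr'"]) (use 2 exec.IfFalse in auto)
  qed
next
  case (PFor x j p)
  let ?b = "Less (Reg x) (Get 0 (Num j))"
  let ?c = "Seq (compile p) (Assign x (Plus (Reg x) (Num 1)))"
  let ?g = "\<lambda>i t. eff p (setr x i t)" and ?f = "\<lambda>i t. outs p (setr x i t)"
  define N where "N = snd s 0 j"
  have x: "x \<notin> wregs p" and wf: "wf_prog p" using PFor.prems by auto
  \<comment> \<open>Starting at an arbitrary \<open>i\<close> lets the induction run over the
    remaining rounds \<open>N - i\<close>; the summand 4 is the final failing test.\<close>
  have loop: "\<exists>tr. exec (While ?b ?c) (setr x i t) tr (setr x N (fold ?g [i..<N] t)) \<and>
      length tr \<le> (N - i) * (time (snd s 0) p + 8) + 4 \<and> nonstep tr = loop_outs ?f ?g [i..<N] t"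
    if "i \<le> N" "snd t 0 = snd s 0" for i t
    using that
  proof (induction "N - i" arbitrary: i t)
    case 0
    then have [simp]: "i = N" by simp
    have "\<not> bval ?b (setr x N t)" using 0 by (simp add: N_def)
    from exec.WhileFalse[OF this, of ?c] show ?case
      by (intro exI[of _ "steps (bcost ?b)"]) (use 0 in \<open>auto simp: fun_upd_def\<close>)
  next
    case (Suc d)
    let ?t = "?g i t"
    have i: "i < N" using Suc.hyps(2) by simp
    obtain tr where 1: "exec (compile p) (setr x i t) tr ?t" "length tr \<le> time (snd s 0) p"
      "nonstep tr = ?f i t" using PFor.IH[OF wf, of "setr x i t"] Suc.prems by auto
    have "fst ?t x = i" using x by (simp add: fst_eff)
    then have "exec (Assign x (Plus (Reg x) (Num 1))) ?t (steps 4) (setr x (Suc i) ?t)"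
      using exec.Assign[of x "Plus (Reg x) (Num 1)" ?t] by (simp add: numeral_eq_Suc)
    then have 2: "exec ?c (setr x i t) (tr @ steps 4) (setr x (Suc i) ?t)"
      using 1 exec.Seq by blast
    have "d = N - Suc i" "Suc i \<le> N" "snd ?t 0 = snd s 0"
      using Suc.prems Suc.hyps(2) i wf by (auto simp: eff_input)
    from Suc.hyps(1)[OF this] obtain tr' where 3:
      "exec (While ?b ?c) (setr x (Suc i) ?t) tr' (setr x N (fold ?g [Suc i..<N] ?t))"
      "length tr' \<le> (N - Suc i) * (time (snd s 0) p + 8) + 4"
      "nonstep tr' = loop_outs ?f ?g [Suc i..<N] ?t"
      by blast
    have b: "bval ?b (setr x i t)" using i Suc.prems by (simp add: N_def)
    have u: "[i..<N] = i # [Suc i..<N]" using i by (simp add: upt_rec)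
    have n: "(N - i) * (time (snd s 0) p + 8) = (N - Suc i) * (time (snd s 0) p + 8) + time (snd s 0) p + 8"
      using i by (metis Suc_diff_Suc add.commute mult_Suc add.assoc)
    show ?case
      by (rule exI[of _ "steps (bcost ?b) @ (tr @ steps 4) @ tr'"])
        (use exec.WhileTrue[OF b 2 3(1)] 1 3 n in \<open>auto simp: u\<close>)
  qed
  obtain tr where 1: "exec (While ?b ?c) (setr x 0 s) tr (setr x N (fold ?g [0..<N] s))"
    "length tr \<le> N * (time (snd s 0) p + 8) + 4" "nonstep tr = loop_outs ?f ?g [0..<N] s"
    using loop[of 0 s] by auto
  have "exec (Assign x (Num 0)) s (steps 2) (setr x 0 s)"
    using exec.Assign[of x "Num 0" s] by (simp add: numeral_eq_Suc)
  from exec.Seq[OF this 1(1)] show ?case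
    by (intro exI[of _ "steps 2 @ tr"]) (use 1 in \<open>auto simp: N_def\<close>)
next
  case PSkip
  show ?case by (rule exI[of _ "[Step]"]) (auto intro: exec.intros)
next
  case (PAssign x a)
  show ?case by (rule exI[of _ "steps (acost a + 1)"]) (use exec.Assign in auto)
next
  case (PStore A a b)
  show ?case by (rule exI[of _ "steps (acost a + acost b + 1)"]) (use exec.Store in auto)
next
  case (PPut a)
  show ?case by (rule exI[of _ "steps (acost a) @ [Elem (aval a s)]"]) (use exec.Put in auto)
next
  case PEmit
  show ?case by (rule exI[of _ "[Output]"]) (use exec.Emit in auto)
qed

text \<open>The step also receives the frame of the body relative to the state before the loop, so
  an invariant need not mention what the body leaves alone. The exit writes the bound into the
  counter, which is why \<open>final\<close> asks that the completed invariant survive any value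
  there.\<close>

lemma For_invariant:
  assumes wf: "wf_prog (PFor x j b)"
    and init: "I 0 [] s"
    and step: "\<And>i es t. i < snd s 0 j \<Longrightarrow> I i es t \<Longrightarrow>
        (\<And>y. y \<notin> insert x (wregs b) \<Longrightarrow> fst t y = fst s y) \<Longrightarrow>
        (\<And>A. A \<notin> warrs b \<Longrightarrow> snd t A = snd s A) \<Longrightarrow>
        I (Suc i) (es @ outs b (setr x i t)) (eff b (setr x i t))"
    and final: "\<And>es t a. I (snd s 0 j) es t \<Longrightarrow> I (snd s 0 j) es (setr x a t)"
  shows "I (snd s 0 j) (outs (PFor x j b) s) (eff (PFor x j b) s)"
proof -
  let ?g = "\<lambda>i t. eff b (setr x i t)" and ?f = "\<lambda>i t. outs b (setr x i t)"
  define N where "N = snd s 0 j"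
  have "I N (es @ loop_outs ?f ?g [i..<N] t) (fold ?g [i..<N] t)"
    if "i \<le> N" "I i es t" "\<And>y. y \<notin> insert x (wregs b) \<Longrightarrow> fst t y = fst s y"
       "\<And>A. A \<notin> warrs b \<Longrightarrow> snd t A = snd s A" for i es t
    using that
  proof (induction "N - i" arbitrary: i es t)
    case 0
    then show ?case by simp
  next
    case (Suc d)
    have i: "i < N" using Suc.hyps(2) by simp
    have u: "[i..<N] = i # [Suc i..<N]" using i by (simp add: upt_rec)
    have "I (Suc i) (es @ ?f i t) (?g i t)"
      using step i Suc.prems by (simp add: N_def)
    then have "I N ((es @ ?f i t) @ loop_outs ?f ?g [Suc i..<N] (?g i t)) (fold ?g [Suc i..<N] (?g i t))"
      using i Suc.hyps(2) Suc.prems by (intro Suc.hyps(1)) (auto simp: fst_eff snd_eff)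
    then show ?case by (simp add: u)
  qed
  from this[of 0 "[]" s] init final show ?thesis by (auto simp: N_def)
qed

lemma For_invariant_eff:
  assumes "wf_prog (PFor x j b)" "I 0 s"
    and "\<And>i t. i < snd s 0 j \<Longrightarrow> I i t \<Longrightarrow>
        (\<And>y. y \<notin> insert x (wregs b) \<Longrightarrow> fst t y = fst s y) \<Longrightarrow>
        (\<And>A. A \<notin> warrs b \<Longrightarrow> snd t A = snd s A) \<Longrightarrow> I (Suc i) (eff b (setr x i t))"
    and "\<And>t a. I (snd s 0 j) t \<Longrightarrow> I (snd s 0 j) (setr x a t)"
  shows "I (snd s 0 j) (eff (PFor x j b) s)"
  by (rule For_invariant[where I = "\<lambda>i es t. I i t"]) (use assms in auto)

declare eff.simps(6) [simp del] outs.simps(6) [simp del]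

subsection \<open>Orders of growth\<close>

text \<open>The cells 0 and 1 of the input array hold the numbers of vertices and edges.\<close>

definition ord :: "prog \<Rightarrow> nat \<Rightarrow> nat \<Rightarrow> bool" where
  "ord p i j \<longleftrightarrow> (\<exists>C. \<forall>f. time f p \<le> C * ((f 1 + 1) ^ i * (f 0 + 1) ^ j))"

lemma ord_const: "(\<And>f. time f p = c) \<Longrightarrow> ord p 0 0"
  unfolding ord_def by (metis mult.right_neutral order_refl power_0)

lemma ord_mono:
  assumes "ord p i j" "i \<le> i'" "j \<le> j'"
  shows "ord p i' j'"
proof -
  obtain C where C: "time f p \<le> C * ((f 1 + 1) ^ i * (f 0 + 1) ^ j)" for f
    using assms(1) ord_def by auto
  have "(f 1 + 1) ^ i * (f 0 + 1) ^ j \<le> (f 1 + 1) ^ i' * (f 0 + 1) ^ j'" for f :: "nat \<Rightarrow> nat"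
    using assms by (intro mult_mono power_increasing) auto
  then have "time f p \<le> C * ((f 1 + 1) ^ i' * (f 0 + 1) ^ j')" for f
    using C[of f] by (meson le_trans mult_le_mono2)
  then show ?thesis by (auto simp: ord_def)
qed

lemma ord_basic:
  "ord PSkip i j" "ord (PAssign x a) i j" "ord (PStore A a b) i j" "ord (PPut a) i j" "ord PEmit i j"
  by (rule ord_mono[OF ord_const], simp, simp, simp)+

lemma ord_Seq:
  assumes "ord p i j" "ord q i j"
  shows "ord (p ;; q) i j"
proof -
  obtain C D where "time f p \<le> C * ((f 1 + 1) ^ i * (f 0 + 1) ^ j)"
    "time f q \<le> D * ((f 1 + 1) ^ i * (f 0 + 1) ^ j)" for f
    using assms ord_def by metis
  then have "time f (p ;; q) \<le> (C + D) * ((f 1 + 1) ^ i * (f 0 + 1) ^ j)" for f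
    by (simp add: add_mult_distrib add_mono)
  then show ?thesis unfolding ord_def by blast
qed

lemma ord_If:
  assumes "ord p i j" "ord q i j"
  shows "ord (PIf b p q) i j"
proof -
  obtain C D where *: "time f p \<le> C * ((f 1 + 1) ^ i * (f 0 + 1) ^ j)"
    "time f q \<le> D * ((f 1 + 1) ^ i * (f 0 + 1) ^ j)" for f
    using assms ord_def by metis
  have "time f (PIf b p q) \<le> (bcost b + C + D) * ((f 1 + 1) ^ i * (f 0 + 1) ^ j)" for f
  proof -
    define P where "P = (f 1 + 1) ^ i * (f 0 + 1) ^ j"
    have "bcost b * 1 \<le> bcost b * P"
      unfolding P_def by (intro mult_le_mono2) (simp add: Suc_leI)
    then have "time f (PIf b p q) \<le> (bcost b + C + D) * P"
      using *[of f, folded P_def] unfolding time.simps add_mult_distrib by linarith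
    then show ?thesis by (simp add: P_def)
  qed
  then show ?thesis unfolding ord_def by blast
qed

text \<open>The overheads 8 and 6 of a loop are absorbed into 14 because \<open>1 \<le> P\<close>.
  Powers of the successors of the vertex and edge counts satisfy this even when a loop runs zero
  times.\<close>

lemma loop_bound:
  fixes C :: nat
  assumes "t \<le> C * P" "1 \<le> P"
  shows "l * (t + 8) + 6 \<le> (C + 14) * ((l + 1) * P)"
proof -
  have "t + 8 \<le> (C + 8) * P" "6 \<le> 6 * P"
    using assms by (auto simp: add_mult_distrib)
  then have "l * (t + 8) \<le> l * ((C + 8) * P)" by (intro mult_le_mono2)
  moreover have "(C + 14) * ((l + 1) * P) = l * ((C + 8) * P) + 6 * (l * P) + C * P + 14 * P"
    by (simp add: algebra_simps)
  ultimately show ?thesis using \<open>6 \<le> 6 * P\<close> by linarith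
qed

lemma ord_For_vertices:
  assumes "ord p i j"
  shows "ord (PFor x 0 p) i (Suc j)"
proof -
  obtain C where "time f p \<le> C * ((f 1 + 1) ^ i * (f 0 + 1) ^ j)" for f
    using assms ord_def by auto
  from loop_bound[OF this, where l = "f 0" for f]
  have "time f (PFor x 0 p) \<le> (C + 14) * ((f 0 + 1) * ((f 1 + 1) ^ i * (f 0 + 1) ^ j))" for f
    by (simp add: Suc_leI)
  then have "time f (PFor x 0 p) \<le> (C + 14) * ((f 1 + 1) ^ i * (f 0 + 1) ^ Suc j)" for f
    by (simp only: power_Suc mult.left_commute)
  then show ?thesis unfolding ord_def by blast
qed

lemma ord_For_edges:
  assumes "ord p i j"
  shows "ord (PFor x (Suc 0) p) (Suc i) j"
proof -
  obtain C where "time f p \<le> C * ((f 1 + 1) ^ i * (f 0 + 1) ^ j)" for f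
    using assms ord_def by auto
  from loop_bound[OF this, where l = "f 1" for f]
  have "time f (PFor x (Suc 0) p) \<le> (C + 14) * ((f 1 + 1) * ((f 1 + 1) ^ i * (f 0 + 1) ^ j))" for f
    by (simp add: Suc_leI)
  then have "time f (PFor x (Suc 0) p) \<le> (C + 14) * ((f 1 + 1) ^ Suc i * (f 0 + 1) ^ j)" for f
    by (simp only: power_Suc mult.assoc)
  then show ?thesis unfolding ord_def by blast
qed

lemmas ord_intros = ord_basic ord_Seq ord_If ord_For_vertices ord_For_edges

section \<open>Degeneracy\<close>

abbreviation nbs :: "'a set set \<Rightarrow> 'a \<Rightarrow> 'a set" where
  "nbs E v \<equiv> {u. {u, v} \<in> E}"

definition degen :: "'a set set \<Rightarrow> nat \<Rightarrow> 'a set \<Rightarrow> bool" where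
  "degen E k S \<longleftrightarrow> (\<forall>T\<subseteq>S. T \<noteq> {} \<longrightarrow> (\<exists>v\<in>T. card (T \<inter> nbs E v) \<le> k))"

text \<open>Deleting edges only lowers degrees, so among the subgraphs on a vertex set
  \<open>T\<close> the induced one is the critical case. Its edges at \<open>v\<close> correspond to
  the neighbours of \<open>v\<close> in \<open>T\<close>.\<close>

lemma degenerate_induced_iff:
  assumes G: "simple_graph G" and S: "S \<subseteq> fst G"
  shows "degenerate k (induced G S) \<longleftrightarrow> degen (snd G) k S"
proof
  have fin: "finite S" using G S finite_subset by (auto simp: simple_graph_def)
  have E: "e \<subseteq> fst G \<and> card e = 2" if "e \<in> snd G" for e
    using G that by (auto simp: simple_graph_def)
  have finE: "finite (snd G)"
    using G E by (intro finite_subset[of "snd G" "Pow (fst G)"]) (auto simp: simple_graph_def)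
  {
    assume d: "degenerate k (induced G S)"
    show "degen (snd G) k S"
      unfolding degen_def
    proof (intro allI impI)
      fix T assume T: "T \<subseteq> S" "T \<noteq> {}"
      have "subgraph (induced G T) (induced G S)"
        using T fin E finite_subset by (auto simp: subgraph_def induced_def simple_graph_def)
      then obtain v where v: "v \<in> T" "vertex_degree (induced G T) v \<le> k"
        using d T by (force simp: degenerate_def induced_def)
      have "card ((\<lambda>u. {u, v}) ` (T \<inter> nbs (snd G) v)) \<le> card {e \<in> snd (induced G T). v \<in> e}"
        using v(1) by (intro card_mono finite_subset[OF _ finE]) (auto simp: induced_def)
      moreover have "inj_on (\<lambda>u. {u, v}) (T \<inter> nbs (snd G) v)"
        by (auto simp: inj_on_def doubleton_eq_iff)
      ultimately have "card (T \<inter> nbs (snd G) v) \<le> k"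
        using v(2) by (simp add: card_image vertex_degree_def)
      then show "\<exists>v\<in>T. card (T \<inter> nbs (snd G) v) \<le> k" using v(1) by blast
    qed
  next
    assume d: "degen (snd G) k S"
    show "degenerate k (induced G S)"
      unfolding degenerate_def
    proof (intro allI impI, elim conjE)
      fix H assume H: "subgraph H (induced G S)" "fst H \<noteq> {}"
      have HS: "fst H \<subseteq> S" "snd H \<subseteq> snd G" and HE: "\<And>e. e \<in> snd H \<Longrightarrow> e \<subseteq> fst H \<and> card e = 2"
        using H by (auto simp: subgraph_def induced_def simple_graph_def)
      obtain v where v: "v \<in> fst H" "card (fst H \<inter> nbs (snd G) v) \<le> k"
        using d HS(1) H(2) unfolding degen_def by blast
      have f: "finite (fst H \<inter> nbs (snd G) v)" using HS fin finite_subset by blast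
      have "{e \<in> snd H. v \<in> e} \<subseteq> (\<lambda>u. {u, v}) ` (fst H \<inter> nbs (snd G) v)"
      proof
        fix e assume "e \<in> {e \<in> snd H. v \<in> e}"
        then have e: "e \<in> snd H" "v \<in> e" by auto
        then obtain u where "e = {u, v}" using HE[OF e(1)] by (auto simp: card_2_iff)
        then show "e \<in> (\<lambda>u. {u, v}) ` (fst H \<inter> nbs (snd G) v)"
          using e HE[OF e(1)] HS by auto
      qed
      then have "vertex_degree H v \<le> card ((\<lambda>u. {u, v}) ` (fst H \<inter> nbs (snd G) v))"
        unfolding vertex_degree_def using f by (intro card_mono) auto
      also have "\<dots> \<le> k" using card_image_le[OF f] v(2) le_trans by blast
      finally show "\<exists>v\<in>fst H. vertex_degree H v \<le> k" using v(1) by blast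
    qed
  }
qed

lemma degen_subset: "degen E k S \<Longrightarrow> T \<subseteq> S \<Longrightarrow> degen E k T"
  by (auto simp: degen_def)

lemma degen_empty [simp]: "degen E k {}"
  by (auto simp: degen_def)

text \<open>A subset containing \<open>v\<close> has \<open>v\<close> itself as a vertex of low
  degree; any other subset already lies in \<open>S - {v}\<close>.\<close>

lemma degen_insert:
  assumes "degen E k (S - {v})" "card (S \<inter> nbs E v) \<le> k" "finite S"
  shows "degen E k S"
  unfolding degen_def
proof (intro allI impI)
  fix T assume T: "T \<subseteq> S" "T \<noteq> {}"
  show "\<exists>u\<in>T. card (T \<inter> nbs E u) \<le> k"
  proof (cases "v \<in> T")
    case True
    have "card (T \<inter> nbs E v) \<le> card (S \<inter> nbs E v)"
      using T assms by (intro card_mono) auto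
    then show ?thesis using True assms by (meson le_trans)
  next
    case False
    then have "T \<subseteq> S - {v}" using T by blast
    then show ?thesis using assms(1) T unfolding degen_def by blast
  qed
qed

text \<open>A vertex of low degree in \<open>S\<close> is placed last, and the rest is ordered
  recursively.\<close>

lemma degeneracy_order:
  assumes "degen E k S" "finite S"
  shows "\<exists>vs. set vs = S \<and> (\<forall>i<length vs. card (set (take i vs) \<inter> nbs E (vs ! i)) \<le> k)"
  using assms(2,1)
proof (induction S rule: finite_psubset_induct)
  case (psubset S)
  show ?case
  proof (cases "S = {}")
    case False
    then obtain v where v: "v \<in> S" "card (S \<inter> nbs E v) \<le> k"
      using psubset.prems by (auto simp: degen_def)
    have "S - {v} \<subset> S" using v by blast
    then obtain vs where vs: "set vs = S - {v}"
      "\<And>i. i < length vs \<Longrightarrow> card (set (take i vs) \<inter> nbs E (vs ! i)) \<le> k"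
      using psubset.IH[of "S - {v}"] psubset.prems degen_subset by (metis Diff_subset)
    have "card ((S - {v}) \<inter> nbs E v) \<le> k"
      using v(2) psubset.hyps by (meson card_mono finite_Int Int_mono Diff_subset le_trans order_refl)
    then show ?thesis
      using vs v(1) by (intro exI[of _ "vs @ [v]"]) (auto simp: nth_append less_Suc_eq)
  qed auto
qed

section \<open>Solutions, greedy completion and proximity\<close>

locale vgraph =
  fixes n :: nat and E :: "nat set set" and k :: nat
  assumes edge: "e \<in> E \<Longrightarrow> e \<subseteq> {..<n} \<and> card e = 2"
begin

lemma no_loop: "{u, u} \<notin> E"
  using edge[of "{u, u}"] by auto

lemma edge_less: "{u, v} \<in> E \<Longrightarrow> u < n \<and> v < n"
  using edge[of "{u, v}"] by auto

abbreviation dg :: "nat set \<Rightarrow> bool" where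
  "dg \<equiv> degen E k"

text \<open>Only extensions by one vertex are considered, as in the greedy completion; heredity
  makes this equivalent to inclusion-maximality.\<close>

definition Sol :: "nat set set" where
  "Sol = {S. S \<subseteq> {..<n} \<and> dg S \<and> (\<forall>v<n. v \<notin> S \<longrightarrow> \<not> dg (insert v S))}"

lemma finite_Sol: "finite Sol"
  by (rule finite_subset[of _ "Pow {..<n}"]) (auto simp: Sol_def)

lemma Sol_finite: "S \<in> Sol \<Longrightarrow> finite S"
  by (rule finite_subset[of _ "{..<n}"]) (auto simp: Sol_def)

primrec completion_upto :: "nat \<Rightarrow> nat set \<Rightarrow> nat set" where
  "completion_upto 0 T = T"
| "completion_upto (Suc i) T =
    (if dg (insert i (completion_upto i T)) then insert i (completion_upto i T) else completion_upto i T)"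

definition completion :: "nat set \<Rightarrow> nat set" where
  "completion T = completion_upto n T"

lemma completion_upto_mono: "i \<le> j \<Longrightarrow> completion_upto i T \<subseteq> completion_upto j T"
  by (induction j) (auto simp: le_Suc_eq)

lemma completion_upto_dg: "dg T \<Longrightarrow> dg (completion_upto i T)"
  by (induction i) auto

lemma completion_upto_subset: "T \<subseteq> {..<n} \<Longrightarrow> i \<le> n \<Longrightarrow> completion_upto i T \<subseteq> {..<n}"
  by (induction i) auto

lemma completion_superset: "T \<subseteq> completion T"
  unfolding completion_def using completion_upto_mono[of 0 n T] by simp

text \<open>One pass suffices: if \<open>v\<close> could still be added at the end, then by heredity
  it could have been added at its turn, when the set was smaller.\<close>

lemma completion_Sol:
  assumes "dg T" "T \<subseteq> {..<n}"
  shows "completion T \<in> Sol"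
proof -
  have "v \<in> completion T" if "v < n" "dg (insert v (completion T))" for v
  proof -
    have "completion_upto v T \<subseteq> completion T" "completion_upto (Suc v) T \<subseteq> completion T"
      unfolding completion_def using that(1) by (intro completion_upto_mono; simp)+
    moreover have "dg (insert v (completion_upto v T))"
      using calculation(1) that(2) by (meson degen_subset insert_mono)
    ultimately show ?thesis by auto
  qed
  then show ?thesis
    using assms completion_upto_dg completion_upto_subset unfolding Sol_def completion_def by blast
qed

text \<open>A guess is a function \<open>L\<close> rather than a set, so that nested loops can
  enumerate it. Intersecting with \<open>S\<close> makes repeated entries and entries outside
  \<open>S\<close> harmless.\<close>

definition seed :: "nat set \<Rightarrow> nat \<Rightarrow> (nat \<Rightarrow> nat) \<Rightarrow> nat set" where
  "seed S v L = insert v ((S - nbs E v) \<union> (S \<inter> L ` {..<k}))"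

abbreviation cand :: "nat set \<Rightarrow> nat \<Rightarrow> (nat \<Rightarrow> nat) \<Rightarrow> nat set" where
  "cand S v L \<equiv> completion (seed S v L)"

lemma seed_subset: "S \<subseteq> {..<n} \<Longrightarrow> v < n \<Longrightarrow> seed S v L \<subseteq> {..<n}"
  by (auto simp: seed_def)

text \<open>At most \<open>k\<close> neighbours of \<open>v\<close> survive whatever
  \<open>L\<close> is, and without \<open>v\<close> the seed is part of \<open>S\<close>. So a guess
  never has to be checked.\<close>

lemma seed_dg:
  assumes "dg S" "finite S"
  shows "dg (seed S v L)"
proof (rule degen_insert)
  show "dg (seed S v L - {v})"
    by (rule degen_subset[OF assms(1)]) (auto simp: seed_def)
  have "seed S v L \<inter> nbs E v \<subseteq> L ` {..<k}"
    using no_loop by (auto simp: seed_def)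
  then have "card (seed S v L \<inter> nbs E v) \<le> card (L ` {..<k})"
    by (intro card_mono) auto
  also have "\<dots> \<le> k" using card_image_le[of "{..<k}" L] by simp
  finally show "card (seed S v L \<inter> nbs E v) \<le> k" .
  show "finite (seed S v L)" using assms by (auto simp: seed_def)
qed

lemma cand_Sol: "S \<in> Sol \<Longrightarrow> v < n \<Longrightarrow> cand S v L \<in> Sol"
  by (intro completion_Sol seed_dg seed_subset) (auto simp: Sol_def Sol_finite)

text \<open>The first entry of the list \<open>L\<close> of retained neighbours is the other end of an edge at the
  new vertex, so that there are only \<open>2 * m * n ^ (k - 1)\<close> choices.\<close>

definition nbrs :: "nat set \<Rightarrow> nat set set" where
  "nbrs S = {cand S v L | v L. {v, L 0} \<in> E \<and> (\<forall>i. 0 < i \<longrightarrow> i < k \<longrightarrow> L i < n)}"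

lemma nbrs_Sol: "S \<in> Sol \<Longrightarrow> nbrs S \<subseteq> Sol"
  using cand_Sol edge_less by (fastforce simp: nbrs_def)

text \<open>A mere choice is enough, since the order only enters the proximity, which no program
  computes.\<close>

definition dorder :: "nat set \<Rightarrow> nat list" where
  "dorder S = (SOME vs. set vs = S \<and> (\<forall>i<length vs. card (set (take i vs) \<inter> nbs E (vs ! i)) \<le> k))"

definition cap :: "nat set \<Rightarrow> nat set \<Rightarrow> nat set" where
  "cap S S' = set (takeWhile (\<lambda>v. v \<in> S) (dorder S'))"

lemma dorder:
  assumes "S \<in> Sol"
  shows "set (dorder S) = S"
    and "i < length (dorder S) \<Longrightarrow> card (set (take i (dorder S)) \<inter> nbs E (dorder S ! i)) \<le> k"
proof -
  have "\<exists>vs. set vs = S \<and> (\<forall>i<length vs. card (set (take i vs) \<inter> nbs E (vs ! i)) \<le> k)"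
    by (rule degeneracy_order) (use assms Sol_finite in \<open>auto simp: Sol_def\<close>)
  from someI_ex[OF this] show "set (dorder S) = S"
    "i < length (dorder S) \<Longrightarrow> card (set (take i (dorder S)) \<inter> nbs E (dorder S ! i)) \<le> k"
    unfolding dorder_def by auto
qed

lemma cap_subset: "S' \<in> Sol \<Longrightarrow> cap S S' \<subseteq> {..<n}"
  using dorder(1)[of S'] set_takeWhileD by (fastforce simp: cap_def Sol_def)

lemma Sol_not_subset: "S \<in> Sol \<Longrightarrow> S' \<in> Sol \<Longrightarrow> S' \<subseteq> S \<Longrightarrow> S' = S"
proof (rule ccontr)
  assume S: "S \<in> Sol" "S' \<in> Sol" "S' \<subseteq> S" "S' \<noteq> S"
  then obtain v where "v \<in> S" "v \<notin> S'" by blast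
  then show False
    using S degen_subset[of E k S "insert v S'"] unfolding Sol_def by blast
qed

lemma proximity:
  assumes S: "S \<in> Sol" "S' \<in> Sol" "S \<noteq> S'"
  shows "\<exists>T\<in>nbrs S. card (cap T S') > card (cap S S')"
proof -
  define vs where "vs = dorder S'"
  define p where "p = takeWhile (\<lambda>v. v \<in> S) vs"
  define l where "l = length p"
  have vs: "set vs = S'" "\<And>i. i < length vs \<Longrightarrow> card (set (take i vs) \<inter> nbs E (vs ! i)) \<le> k"
    unfolding vs_def using dorder[OF S(2)] by auto
  have pS: "set p \<subseteq> S" unfolding p_def using set_takeWhileD by fast
  have p: "p = take l vs" unfolding l_def p_def by (rule takeWhile_eq_take)
  have "\<not> S' \<subseteq> S" using S Sol_not_subset by blast
  then have "p \<noteq> vs" using vs(1) pS by blast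
  then have l: "l < length vs"
    using p by (metis linorder_not_less take_all)
  define v where "v = vs ! l"
  have vS: "v \<notin> S" unfolding v_def using nth_length_takeWhile l by (auto simp: l_def p_def)
  have vn: "v < n" using vs(1) S(2) l nth_mem[OF l] by (auto simp: v_def Sol_def)
  define K where "K = set p \<inter> nbs E v"
  have K: "card K \<le> k" using vs(2)[OF l] unfolding K_def v_def p[symmetric] .
  have K': "finite K" "K \<subseteq> S" using pS by (simp add: K_def, unfold K_def, blast)
  \<comment> \<open>An isolated vertex outside \<open>S\<close> could be added to \<open>S\<close>.
    So an edge at \<open>v\<close> exists even if no neighbour has to be retained, as is always the
    case for \<open>k = 0\<close>.\<close>
  have "\<exists>u. {u, v} \<in> E"
  proof (rule ccontr)
    assume "\<nexists>u. {u, v} \<in> E"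
    then have "nbs E v = {}" by simp
    moreover have "insert v S - {v} = S" using vS by simp
    ultimately have "dg (insert v S)"
      using S(1) Sol_finite[OF S(1)] degen_insert[of E k "insert v S" v] by (simp add: Sol_def)
    then show False using S(1) vS vn by (auto simp: Sol_def)
  qed
  then obtain u where u: "{u, v} \<in> E" by blast
  obtain L where L: "{v, L 0} \<in> E" "\<And>i. L i < n" "K \<subseteq> L ` {..<k}"
  proof (cases "K = {}")
    case True
    with that[of "\<lambda>_. u"] u edge_less[OF u] show ?thesis by (simp add: insert_commute)
  next
    case False
    then obtain f where f: "K = f ` {..<card K}"
      using K'(1) by (metis finite_imp_nat_seg_image_inj_on card_Collect_less_nat card_image lessThan_def)
    \<comment> \<open>Padding with \<open>f 0\<close> keeps all entries in \<open>K\<close>. In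
      particular \<open>L 0\<close> is a neighbour of \<open>v\<close> and every entry is below
      \<open>n\<close>.\<close>
    define L where "L i = f (if i < card K then i else 0)" for i
    have c: "0 < card K" using False K'(1) by (simp add: card_gt_0_iff)
    have LK: "L i \<in> K" for i unfolding L_def using f c by auto
    have "K \<subseteq> L ` {..<k}"
    proof
      fix x assume "x \<in> K"
      then obtain i where "i < card K" "x = f i" using f by auto
      then have "x = L i" "i < k" using K by (auto simp: L_def)
      then show "x \<in> L ` {..<k}" by blast
    qed
    moreover have "{v, L 0} \<in> E" "L i < n" for i
      using LK[of 0] LK[of i] edge_less by (auto simp: K_def insert_commute)
    ultimately show ?thesis using that by blast
  qed
  define T where "T = cand S v L"
  have "T \<in> nbrs S" unfolding T_def nbrs_def using L by blast
  moreover have "card (cap S S') < card (cap T S')"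
  proof -
    have "set p \<subseteq> seed S v L"
      using L(3) K_def pS by (auto simp: seed_def)
    moreover have "v \<in> seed S v L" by (simp add: seed_def)
    ultimately have in_T: "x \<in> T" if "x \<in> set (p @ [v])" for x
      using that completion_superset[of "seed S v L"] by (auto simp: T_def)
    have "vs = (p @ [v]) @ drop (Suc l) vs"
      using id_take_nth_drop[OF l] by (simp add: v_def p)
    then have "takeWhile (\<lambda>v. v \<in> T) vs = (p @ [v]) @ takeWhile (\<lambda>v. v \<in> T) (drop (Suc l) vs)"
      using in_T by (metis takeWhile_append2)
    then have "insert v (set p) \<subseteq> cap T S'" by (auto simp: cap_def vs_def)
    then have "card (insert v (set p)) \<le> card (cap T S')"
      by (intro card_mono) (auto simp: cap_def)
    moreover have "v \<notin> set p" using vS pS by auto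
    moreover have "cap S S' = set p" by (simp add: cap_def p_def vs_def)
    ultimately show ?thesis by simp
  qed
  ultimately show ?thesis by blast
qed

text \<open>If a solution \<open>S'\<close> were missing, the member of \<open>Q\<close> closest to
  \<open>S'\<close> would have a neighbour in \<open>Q\<close> that is even closer.\<close>

lemma reachable:
  assumes Q: "Q \<subseteq> Sol" "Q \<noteq> {}" and closed: "\<And>S. S \<in> Q \<Longrightarrow> nbrs S \<subseteq> Q"
  shows "Q = Sol"
proof (rule ccontr)
  assume "Q \<noteq> Sol"
  then obtain S' where S': "S' \<in> Sol" "S' \<notin> Q" using Q by blast
  have "finite Q" using Q(1) finite_Sol finite_subset by blast
  then have "Max ((\<lambda>S. card (cap S S')) ` Q) \<in> (\<lambda>S. card (cap S S')) ` Q"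
    using Q(2) by (intro Max_in) auto
  then obtain S where "S \<in> Q" "card (cap S S') = Max ((\<lambda>S. card (cap S S')) ` Q)" by auto
  then have S: "S \<in> Q" "\<And>T. T \<in> Q \<Longrightarrow> card (cap T S') \<le> card (cap S S')"
    using \<open>finite Q\<close> by auto
  obtain T where "T \<in> nbrs S" "card (cap T S') > card (cap S S')"
    using S(1) proximity[of S S'] S' Q by blast
  then show False using S closed by (meson leD subsetD)
qed

end

lemma maximal_degenerate_eq:
  assumes G: "simple_graph G" "fst G = {..<n}"
  shows "maximal_degenerate k G = vgraph.Sol n (snd G) k"
proof -
  interpret vgraph n "snd G" k
    using G by unfold_locales (auto simp: simple_graph_def)
  have "(\<forall>T. S \<subset> T \<and> T \<subseteq> {..<n} \<longrightarrow> \<not> dg T) \<longleftrightarrow> (\<forall>v<n. v \<notin> S \<longrightarrow> \<not> dg (insert v S))"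
    if "S \<subseteq> {..<n}" for S
  proof
    assume *: "\<forall>v<n. v \<notin> S \<longrightarrow> \<not> dg (insert v S)"
    show "\<forall>T. S \<subset> T \<and> T \<subseteq> {..<n} \<longrightarrow> \<not> dg T"
    proof (intro allI impI notI)
      fix T assume T: "S \<subset> T \<and> T \<subseteq> {..<n}" "dg T"
      then obtain v where "v \<in> T" "v \<notin> S" by blast
      then show False using * T degen_subset[of "snd G" k T "insert v S"] by blast
    qed
  next
    assume *: "\<forall>T. S \<subset> T \<and> T \<subseteq> {..<n} \<longrightarrow> \<not> dg T"
    show "\<forall>v<n. v \<notin> S \<longrightarrow> \<not> dg (insert v S)"
    proof (intro allI impI)
      fix v assume "v < n" "v \<notin> S"
      then show "\<not> dg (insert v S)" using * that by (intro *[rule_format]) auto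
    qed
  qed
  then show ?thesis
    using degenerate_induced_iff[OF G(1)] G(2)
    unfolding maximal_degenerate_def Sol_def
    by (intro Collect_cong) auto
qed

section \<open>The subroutines\<close>

text \<open>Array 0 is the input graph, array 1 the input set, array 2 holds the powers of two and array 3
  the adjacency relation, indexed by the code \<open>2 ^ u + 2 ^ v\<close> of an unordered pair.\<close>

abbreviation vertices :: "nat \<Rightarrow> prog \<Rightarrow> prog" where
  "vertices x p \<equiv> PFor x 0 p"

abbreviation adj :: "aexp \<Rightarrow> aexp \<Rightarrow> bexp" where
  "adj a b \<equiv> Eq (Get 3 (Plus (Get 2 a) (Get 2 b))) (Num 1)"

text \<open>Register 8 is the counter of the loop over edges. Edge \<open>i\<close> occupies the
  cells \<open>2 * i + 2\<close> and \<open>2 * i + 3\<close>, behind the two counts, and doubling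
  is an addition.\<close>

definition edge_end :: "nat \<Rightarrow> aexp" where
  "edge_end c = Get 0 (Plus (Reg 8) (Plus (Reg 8) (Num (Suc (Suc c)))))"

lemma aval_edge_end [simp]:
  "aval (edge_end 0) s = snd s 0 (fst s 8 + fst s 8 + 2)"
  "aval (edge_end (Suc 0)) s = snd s 0 (fst s 8 + fst s 8 + 3)"
  by (simp_all add: edge_end_def eval_nat_numeral)

text \<open>The code \<open>2 ^ u + 2 ^ v\<close> needs neither a multiplication nor an order of the
  ends. One store per edge covers both orientations, and adjacency is then tested in constant
  time.\<close>

definition prepare :: prog where
  "prepare = PAssign 6 (Num 1) ;;
     vertices 2 (PStore 2 (Reg 2) (Reg 6) ;; PAssign 6 (Plus (Reg 6) (Reg 6))) ;;
     PFor 8 (Suc 0) (PStore 3 (Plus (Get 2 (edge_end 0)) (Get 2 (edge_end (Suc 0)))) (Num 1))"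

text \<open>The characteristic function of the set under construction is in array 4. A test decides in
  register 1 whether that set is degenerate, given that it was before the vertex in register 0 was
  added. Peeling removes vertices of degree at most \<open>k\<close>; array 5 holds the remaining set and array
  6 the degrees in it. Peeling is too slow when \<open>k = 0\<close>, where the set has to be independent.\<close>

definition count_degrees :: prog where
  "count_degrees = vertices 2 (PStore 5 (Reg 2) (Get 4 (Reg 2)) ;; PStore 6 (Reg 2) (Num 0) ;;
     vertices 3 (PIf (And (Eq (Get 4 (Reg 3)) (Num 1)) (adj (Reg 3) (Reg 2)))
       (PStore 6 (Reg 2) (Plus (Get 6 (Reg 2)) (Num 1))) PSkip))"

text \<open>Register 5 holds the vertex shifted by one, so that 0 means that none was found.\<close>

definition find_low :: "nat \<Rightarrow> prog" where
  "find_low k = PAssign 5 (Num 0) ;;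
     vertices 3 (PIf (And (Eq (Get 5 (Reg 3)) (Num 1)) (Less (Get 6 (Reg 3)) (Num (Suc k))))
       (PAssign 5 (Plus (Reg 3) (Num 1))) PSkip)"

definition remove_low :: prog where
  "remove_low = PStore 5 (Minus (Reg 5) (Num 1)) (Num 0) ;;
     vertices 3 (PIf (adj (Minus (Reg 5) (Num 1)) (Reg 3))
       (PStore 6 (Reg 3) (Minus (Get 6 (Reg 3)) (Num 1))) PSkip)"

definition check_empty :: prog where
  "check_empty = PAssign 1 (Num 1) ;;
     vertices 2 (PIf (Eq (Get 5 (Reg 2)) (Num 1)) (PAssign 1 (Num 0)) PSkip)"

text \<open>Quadratic time is possible because a removal updates the degrees in one sweep instead of
  recounting them. The rounds are as many as the vertices; those after peeling gets stuck do
  nothing.\<close>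

definition peel :: "nat \<Rightarrow> prog" where
  "peel k = count_degrees ;;
     vertices 2 (find_low k ;; PIf (Less (Num 0) (Reg 5)) remove_low PSkip) ;; check_empty"

definition check_isolated :: prog where
  "check_isolated = PAssign 1 (Num 1) ;;
     vertices 2 (PIf (And (Eq (Get 4 (Reg 2)) (Num 1)) (adj (Reg 2) (Reg 0)))
       (PAssign 1 (Num 0)) PSkip)"

definition test :: "nat \<Rightarrow> prog" where
  "test k = (if k = 0 then check_isolated else peel k)"

definition greedy :: "nat \<Rightarrow> prog" where
  "greedy k = vertices 0 (PStore 4 (Reg 0) (Num 1) ;; test k ;;
     PIf (Eq (Reg 1) (Num 0)) (PStore 4 (Reg 0) (Num 0)) PSkip)"

section \<open>Frames and running times of the subroutines\<close>

lemma frame_prepare: "wregs prepare = {2, 6, 8}" "warrs prepare = {2, 3}" "wf_prog prepare" "silent prepare"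
  by (auto simp: prepare_def)

lemma frame_count_degrees: "wregs count_degrees = {2, 3}" "warrs count_degrees = {5, 6}"
  "wf_prog count_degrees" "silent count_degrees"
  by (auto simp: count_degrees_def)

lemma frame_find_low: "wregs (find_low k) = {3, 5}" "warrs (find_low k) = {}"
  "wf_prog (find_low k)" "silent (find_low k)"
  by (auto simp: find_low_def)

lemma frame_remove_low: "wregs remove_low = {3}" "warrs remove_low = {5, 6}"
  "wf_prog remove_low" "silent remove_low"
  by (auto simp: remove_low_def)

lemma frame_check_empty: "wregs check_empty = {1, 2}" "warrs check_empty = {}"
  "wf_prog check_empty" "silent check_empty"
  by (auto simp: check_empty_def)

lemmas peel_frames = frame_count_degrees frame_find_low frame_remove_low frame_check_empty

lemma frame_test: "wregs (test k) \<subseteq> {1, 2, 3, 5}" "warrs (test k) \<subseteq> {5, 6}"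
  "wf_prog (test k)" "silent (test k)"
  by (auto simp: test_def peel_def check_isolated_def peel_frames)

lemmas notin_test = frame_test(1,2)[THEN contra_subsetD]

lemma frame_greedy: "wregs (greedy k) \<subseteq> {0, 1, 2, 3, 5}" "warrs (greedy k) \<subseteq> {4, 5, 6}"
  "wf_prog (greedy k)" "silent (greedy k)"
  using frame_test[of k] by (auto simp: greedy_def)

lemmas notin_greedy = frame_greedy(1,2)[THEN contra_subsetD]

lemma ord_test: "ord (test k) 0 (if k = 0 then 1 else 2)"
  unfolding test_def peel_def count_degrees_def find_low_def remove_low_def check_empty_def
    check_isolated_def numeral_2_eq_2
  by (auto intro!: ord_intros)

lemma ord_greedy: "ord (greedy k) 0 (if k = 0 then 2 else 3)"
proof -
  have "ord (greedy k) 0 (Suc (if k = 0 then 1 else 2))"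
    unfolding greedy_def by (intro ord_intros ord_test)
  then show ?thesis by (simp split: if_splits add: eval_nat_numeral)
qed

lemma ord_prepare: "ord prepare 1 1"
  unfolding prepare_def One_nat_def
  by (intro ord_intros ord_mono[OF ord_For_vertices[where i = 0 and j = 0]]
      ord_mono[OF ord_For_edges[where i = 0 and j = 0]]) auto

section \<open>Correctness of the subroutines\<close>

definition chr :: "nat \<Rightarrow> (nat \<Rightarrow> nat) \<Rightarrow> nat set \<Rightarrow> bool" where
  "chr n f T \<longleftrightarrow> (\<forall>w<n. f w = of_bool (w \<in> T))"

lemma chr_eq_1: "chr n f T \<Longrightarrow> w < n \<Longrightarrow> f w = Suc 0 \<longleftrightarrow> w \<in> T"
  by (simp add: chr_def)

lemma chr_upd: "chr n f T \<Longrightarrow> chr n (f(v := Suc 0)) (insert v T)" "chr n f T \<Longrightarrow> chr n (f(v := 0)) (T - {v})"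
  by (auto simp: chr_def)

text \<open>Uniqueness of binary digits: the sum has the digits \<open>a\<close> and
  \<open>b\<close> if they differ, and the single digit \<open>Suc a\<close> if they agree. Hence
  marking one edge never touches the cell of another pair.\<close>

lemma pair_code_eq_iff: "(2::nat) ^ a + 2 ^ b = 2 ^ c + 2 ^ d \<longleftrightarrow> {a, b} = {c, d}"
proof -
  have code: "(2::nat) ^ a + 2 ^ b = set_encode (if a = b then {Suc a} else {a, b})" for a b
    by (auto simp: set_encode_def)
  show ?thesis
    unfolding code by (subst set_encode_eq) (auto simp: doubleton_eq_iff)
qed

lemma card_less_Suc:
  "card {u. u < Suc j \<and> P u} = (if P j then Suc (card {u. u < j \<and> P u}) else card {u. u < j \<and> P u})"
proof -
  have "{u. u < Suc j \<and> P u} = (if P j then insert j {u. u < j \<and> P u} else {u. u < j \<and> P u})"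
    by (auto simp: less_Suc_eq)
  then show ?thesis by simp
qed

context vgraph
begin

text \<open>Stated about the contents of arrays 0, 2 and 3 rather than about a state, so that it
  passes by rewriting through every program that leaves these arrays alone.\<close>

definition env :: "(nat \<Rightarrow> nat) \<Rightarrow> (nat \<Rightarrow> nat) \<Rightarrow> (nat \<Rightarrow> nat) \<Rightarrow> bool" where
  "env a p q \<longleftrightarrow> a 0 = n \<and> (\<lambda>i. {a (i + i + 2), a (i + i + 3)}) ` {..<a 1} = E \<and>
     (\<forall>u<n. p u = 2 ^ u) \<and> (\<forall>u<n. \<forall>v<n. q (2 ^ u + 2 ^ v) = of_bool ({u, v} \<in> E))"

abbreviation envs :: "state \<Rightarrow> bool" where
  "envs s \<equiv> env (snd s 0) (snd s 2) (snd s 3)"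

lemma env_n: "env a p q \<Longrightarrow> a 0 = n"
  by (simp add: env_def)

lemma env_adj: "env a p q \<Longrightarrow> u < n \<Longrightarrow> v < n \<Longrightarrow> q (p u + p v) = Suc 0 \<longleftrightarrow> {u, v} \<in> E"
  by (simp add: env_def)

lemma prepare_correct:
  assumes a: "snd s 0 0 = n" "(\<lambda>i. {snd s 0 (i + i + 2), snd s 0 (i + i + 3)}) ` {..<snd s 0 1} = E"
    and z: "snd s 3 = (\<lambda>_. 0)"
  shows "envs (eff prepare s)"
proof -
  let ?p = "vertices 2 (PStore 2 (Reg 2) (Reg 6) ;; PAssign 6 (Plus (Reg 6) (Reg 6)))"
  let ?t0 = "setr 6 1 s"
  define t where "t = eff ?p ?t0"
  have "(\<lambda>i t. fst t 6 = 2 ^ i \<and> (\<forall>u<i. snd t 2 u = 2 ^ u)) (snd ?t0 0 0) (eff ?p ?t0)"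
    by (rule For_invariant_eff) (auto simp: less_Suc_eq)
  then have p: "\<forall>u<n. snd t 2 u = 2 ^ u" using a by (simp add: t_def)
  have t: "snd t 0 = snd s 0" "snd t 3 = (\<lambda>_. 0)" using z by (simp_all add: t_def snd_eff)
  let ?a = "snd s 0"
  let ?e = "\<lambda>i. {?a (i + i + 2), ?a (i + i + 3)}"
  let ?q = "PFor 8 (Suc 0) (PStore 3 (Plus (Get 2 (edge_end 0)) (Get 2 (edge_end (Suc 0)))) (Num 1))"
  have "(\<lambda>i t'. \<forall>u<n. \<forall>v<n. snd t' 3 (2 ^ u + 2 ^ v) = of_bool (\<exists>l<i. {u, v} = ?e l))
    (snd t 0 (Suc 0)) (eff ?q t)"
  proof (rule For_invariant_eff)
    fix i and t' :: state
    assume i: "i < snd t 0 (Suc 0)"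
      and I: "\<forall>u<n. \<forall>v<n. snd t' 3 (2 ^ u + 2 ^ v) = of_bool (\<exists>l<i. {u, v} = ?e l)"
      and f: "\<And>A. A \<notin> warrs (PStore 3 (Plus (Get 2 (edge_end 0)) (Get 2 (edge_end (Suc 0)))) (Num 1))
        \<Longrightarrow> snd t' A = snd t A"
    have t': "snd t' 0 = ?a" "snd t' 2 = snd t 2" using f[of 0] f[of 2] t by auto
    have "?e i \<in> E" using a(2) i t by auto
    then have "?a (i + i + 2) < n" "?a (i + i + 3) < n" using edge_less by blast+
    then have 1: "snd t 2 (?a (i + i + 2)) = 2 ^ ?a (i + i + 2)"
      "snd t 2 (?a (i + i + 3)) = 2 ^ ?a (i + i + 3)" using p by auto
    show "\<forall>u<n. \<forall>v<n. snd (eff (PStore 3 (Plus (Get 2 (edge_end 0)) (Get 2 (edge_end (Suc 0)))) (Num 1))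
        (setr 8 i t')) 3 (2 ^ u + 2 ^ v) = of_bool (\<exists>l<Suc i. {u, v} = ?e l)"
      using I 1 by (auto simp: t' pair_code_eq_iff less_Suc_eq)
  qed (use t in auto)
  then have q: "snd (eff ?q t) 3 (2 ^ u + 2 ^ v) = of_bool ({u, v} \<in> E)" if "u < n" "v < n" for u v
    using that t a(2) by auto
  have "eff prepare s = eff ?q t" by (simp add: prepare_def t_def)
  moreover have "snd (eff ?q t) 0 = snd s 0" "snd (eff ?q t) 2 = snd t 2"
    using t by (simp_all add: snd_eff)
  ultimately show ?thesis using a p q by (simp add: env_def)
qed

lemma count_degrees_correct:
  assumes e: "envs s" and c: "chr n (snd s 4) T" and T: "T \<subseteq> {..<n}"
  defines "s' \<equiv> eff count_degrees s"
  shows "chr n (snd s' 5) T" "\<forall>w<n. snd s' 6 w = card (T \<inter> nbs E w)"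
proof -
  let ?b = "PIf (And (Eq (Get 4 (Reg 3)) (Num 1)) (adj (Reg 3) (Reg 2)))
       (PStore 6 (Reg 2) (Plus (Get 6 (Reg 2)) (Num 1))) PSkip"
  have inner: "snd (eff (vertices 3 ?b) t) 6 = (snd t 6)(w := card (T \<inter> nbs E w))"
    if t: "envs t" "chr n (snd t 4) T" "fst t 2 = w" "w < n" "snd t 6 w = 0" for t w
  proof -
    have "(\<lambda>i t'. snd t' 6 = (snd t 6)(w := card {u. u < i \<and> u \<in> T \<and> {u, w} \<in> E}))
      (snd t 0 0) (eff (vertices 3 ?b) t)"
    proof (rule For_invariant_eff)
      fix i and t' :: state
      assume i: "i < snd t 0 0"
        and I: "snd t' 6 = (snd t 6)(w := card {u. u < i \<and> u \<in> T \<and> {u, w} \<in> E})"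
        and fr: "\<And>y. y \<notin> insert 3 (wregs ?b) \<Longrightarrow> fst t' y = fst t y"
        and fa: "\<And>A. A \<notin> warrs ?b \<Longrightarrow> snd t' A = snd t A"
      have "fst t' 2 = w" "snd t' 4 = snd t 4" "snd t' 2 = snd t 2" "snd t' 3 = snd t 3"
        using fr[of 2] fa[of 4] fa[of 2] fa[of 3] t by auto
      then show "snd (eff ?b (setr 3 i t')) 6 =
          (snd t 6)(w := card {u. u < Suc i \<and> u \<in> T \<and> {u, w} \<in> E})"
        using I i t by (simp add: env_n env_adj chr_eq_1 card_less_Suc)
    qed (use t in \<open>auto simp: fun_upd_idem\<close>)
    moreover have "{u. u < n \<and> u \<in> T \<and> {u, w} \<in> E} = T \<inter> nbs E w" using T by auto
    ultimately show ?thesis using t by (simp add: env_n)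
  qed
  let ?c = "PStore 5 (Reg 2) (Get 4 (Reg 2)) ;; PStore 6 (Reg 2) (Num 0) ;; vertices 3 ?b"
  have "(\<lambda>i t. \<forall>w<i. snd t 5 w = of_bool (w \<in> T) \<and> snd t 6 w = card (T \<inter> nbs E w))
    (snd s 0 0) (eff (vertices 2 ?c) s)"
  proof (rule For_invariant_eff)
    fix i and t :: state
    assume i: "i < snd s 0 0"
      and I: "\<forall>w<i. snd t 5 w = of_bool (w \<in> T) \<and> snd t 6 w = card (T \<inter> nbs E w)"
      and fa: "\<And>A. A \<notin> warrs ?c \<Longrightarrow> snd t A = snd s A"
    have t: "snd t 0 = snd s 0" "snd t 4 = snd s 4" "snd t 2 = snd s 2" "snd t 3 = snd s 3"
      using fa[of 0] fa[of 4] fa[of 2] fa[of 3] by auto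
    let ?t = "eff (PStore 6 (Reg 2) (Num 0)) (eff (PStore 5 (Reg 2) (Get 4 (Reg 2))) (setr 2 i t))"
    have t': "eff ?c (setr 2 i t) = eff (vertices 3 ?b) ?t" by simp
    have 1: "snd (eff (vertices 3 ?b) ?t) 6 = (snd ?t 6)(i := card (T \<inter> nbs E i))"
      by (rule inner) (use i e c env_n in \<open>auto simp: t\<close>)
    have 2: "snd (eff (vertices 3 ?b) ?t) 5 = snd ?t 5" by (rule snd_eff) simp
    show "\<forall>w<Suc i. snd (eff ?c (setr 2 i t)) 5 w = of_bool (w \<in> T) \<and>
        snd (eff ?c (setr 2 i t)) 6 w = card (T \<inter> nbs E w)"
      unfolding t' 1 2 using I i c e by (auto simp: t less_Suc_eq chr_def env_n)
  qed auto
  then show "chr n (snd s' 5) T" "\<forall>w<n. snd s' 6 w = card (T \<inter> nbs E w)"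
    using env_n[OF e] by (auto simp: s'_def count_degrees_def chr_def)
qed

lemma find_low_correct:
  assumes e: "envs s" and c: "chr n (snd s 5) C" and d: "\<forall>w<n. snd s 6 w = card (C \<inter> nbs E w)"
    and C: "C \<subseteq> {..<n}"
  defines "x \<equiv> fst (eff (find_low k) s) 5"
  shows "if x = 0 then \<forall>w\<in>C. card (C \<inter> nbs E w) > k else x - 1 \<in> C \<and> card (C \<inter> nbs E (x - 1)) \<le> k"
proof -
  let ?b = "PIf (And (Eq (Get 5 (Reg 3)) (Num 1)) (Less (Get 6 (Reg 3)) (Num (Suc k))))
       (PAssign 5 (Plus (Reg 3) (Num 1))) PSkip"
  let ?I = "\<lambda>i t. if fst t 5 = 0 then \<forall>w\<in>C. w < i \<longrightarrow> card (C \<inter> nbs E w) > k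
     else fst t 5 - 1 \<in> C \<and> card (C \<inter> nbs E (fst t 5 - 1)) \<le> k"
  have "?I (snd (setr 5 0 s) 0 0) (eff (vertices 3 ?b) (setr 5 0 s))"
  proof (rule For_invariant_eff)
    fix i and t :: state
    assume i: "i < snd (setr 5 0 s) 0 0" and I: "?I i t"
      and fa: "\<And>A. A \<notin> warrs ?b \<Longrightarrow> snd t A = snd (setr 5 0 s) A"
    have t: "snd t 5 = snd s 5" "snd t 6 = snd s 6" using fa[of 5] fa[of 6] by auto
    have i: "i < n" using i e by (simp add: env_n)
    show "?I (Suc i) (eff ?b (setr 3 i t))"
      using I i d chr_eq_1[OF c i] by (auto simp: t less_Suc_eq)
  qed auto
  then show ?thesis using C by (auto simp: x_def find_low_def env_n[OF e])
qed

lemma remove_low_correct: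
  assumes e: "envs s" and c: "chr n (snd s 5) C" and d: "\<forall>w<n. snd s 6 w = card (C \<inter> nbs E w)"
    and C: "C \<subseteq> {..<n}" and x: "fst s 5 = Suc u" "u \<in> C"
  defines "s' \<equiv> eff remove_low s"
  shows "chr n (snd s' 5) (C - {u})" "\<forall>w<n. snd s' 6 w = card ((C - {u}) \<inter> nbs E w)"
proof -
  let ?b = "PIf (adj (Minus (Reg 5) (Num 1)) (Reg 3))
       (PStore 6 (Reg 3) (Minus (Get 6 (Reg 3)) (Num 1))) PSkip"
  let ?s = "eff (PStore 5 (Minus (Reg 5) (Num 1)) (Num 0)) s"
  have u: "u < n" using x C by auto
  have "(\<lambda>i t. snd t 6 = (\<lambda>w. if w < i \<and> {u, w} \<in> E then snd s 6 w - 1 else snd s 6 w))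
    (snd ?s 0 0) (eff (vertices 3 ?b) ?s)"
  proof (rule For_invariant_eff)
    fix i and t :: state
    assume i: "i < snd ?s 0 0"
      and I: "snd t 6 = (\<lambda>w. if w < i \<and> {u, w} \<in> E then snd s 6 w - 1 else snd s 6 w)"
      and fr: "\<And>y. y \<notin> insert 3 (wregs ?b) \<Longrightarrow> fst t y = fst ?s y"
      and fa: "\<And>A. A \<notin> warrs ?b \<Longrightarrow> snd t A = snd ?s A"
    have t: "fst t 5 = Suc u" "snd t 2 = snd s 2" "snd t 3 = snd s 3"
      using fr[of 5] fa[of 2] fa[of 3] x by auto
    have i: "i < n" using i e by (simp add: env_n)
    show "snd (eff ?b (setr 3 i t)) 6 =
        (\<lambda>w. if w < Suc i \<and> {u, w} \<in> E then snd s 6 w - 1 else snd s 6 w)"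
      using I i env_adj[OF e u i] by (auto simp: t less_Suc_eq fun_eq_iff)
  qed auto
  then have 6: "snd s' 6 w = (if {u, w} \<in> E then snd s 6 w - 1 else snd s 6 w)" if "w < n" for w
    using that by (simp add: s'_def remove_low_def env_n[OF e])
  have fC: "finite C" using C finite_subset by blast
  show "\<forall>w<n. snd s' 6 w = card ((C - {u}) \<inter> nbs E w)"
  proof (intro allI impI)
    fix w assume w: "w < n"
    show "snd s' 6 w = card ((C - {u}) \<inter> nbs E w)"
    proof (cases "{u, w} \<in> E")
      case True
      have "(C - {u}) \<inter> nbs E w = (C \<inter> nbs E w) - {u}" by auto
      then show ?thesis using True 6 w d x fC by simp
    next
      case False
      then have "(C - {u}) \<inter> nbs E w = C \<inter> nbs E w" by auto
      then show ?thesis using False 6 w d by simp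
    qed
  qed
  have "snd s' 5 = (snd s 5)(u := 0)"
    using x by (simp add: s'_def remove_low_def snd_eff)
  then show "chr n (snd s' 5) (C - {u})" using chr_upd(2)[OF c] by simp
qed

lemma check_empty_correct:
  assumes e: "envs s" and c: "chr n (snd s 5) C" and C: "C \<subseteq> {..<n}"
  shows "fst (eff check_empty s) 1 = of_bool (C = {})"
proof -
  let ?b = "PIf (Eq (Get 5 (Reg 2)) (Num 1)) (PAssign 1 (Num 0)) PSkip"
  let ?s = "setr 1 1 s"
  have "(\<lambda>i t. fst t 1 = of_bool (C \<inter> {..<i} = {})) (snd ?s 0 0) (eff (vertices 2 ?b) ?s)"
  proof (rule For_invariant_eff)
    fix i and t :: state
    assume i: "i < snd ?s 0 0" and I: "fst t 1 = of_bool (C \<inter> {..<i} = {})"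
      and fa: "\<And>A. A \<notin> warrs ?b \<Longrightarrow> snd t A = snd ?s A"
    have t: "snd t 5 = snd s 5" using fa[of 5] by auto
    have i: "i < n" using i e by (simp add: env_n)
    have "C \<inter> {..<Suc i} = (if i \<in> C then insert i (C \<inter> {..<i}) else C \<inter> {..<i})"
      by (auto simp: lessThan_Suc)
    then show "fst (eff ?b (setr 2 i t)) 1 = of_bool (C \<inter> {..<Suc i} = {})"
      using I i chr_eq_1[OF c i] by (simp add: t)
  qed auto
  moreover have "C \<inter> {..<n} = C" using C by auto
  ultimately show ?thesis by (simp add: check_empty_def env_n[OF e])
qed

text \<open>Since both directions hold, any vertex of low degree may be peeled first, without
  backtracking.\<close>

lemma dg_iff_remove:
  assumes "card (C \<inter> nbs E u) \<le> k" "finite C"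
  shows "dg C \<longleftrightarrow> dg (C - {u})"
  using assms degen_insert degen_subset by (metis Diff_subset)

lemma peel_correct:
  assumes e: "envs s" and c: "chr n (snd s 4) T" and T: "T \<subseteq> {..<n}"
  shows "fst (eff (peel k) s) 1 = of_bool (dg T)"
proof -
  let ?b = "find_low k ;; PIf (Less (Num 0) (Reg 5)) remove_low PSkip"
  define s1 where "s1 = eff count_degrees s"
  define s2 where "s2 = eff (vertices 2 ?b) s1"
  have s1: "snd s1 0 = snd s 0" "snd s1 2 = snd s 2" "snd s1 3 = snd s 3"
    by (simp_all add: s1_def snd_eff peel_frames)
  \<comment> \<open>Each round removes a vertex or finds \<open>C\<close> stuck, with all degrees
    above \<open>k\<close>. After \<open>n\<close> rounds \<open>C\<close> is therefore empty or
    stuck, and a nonempty stuck set refutes its own degeneracy.\<close>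
  let ?I = "\<lambda>i t. \<exists>C. C \<subseteq> {..<n} \<and> chr n (snd t 5) C \<and> (\<forall>w<n. snd t 6 w = card (C \<inter> nbs E w)) \<and>
    (dg T \<longleftrightarrow> dg C) \<and> (card C + i \<le> n \<or> (\<forall>w\<in>C. card (C \<inter> nbs E w) > k))"
  have "?I (snd s1 0 0) s2"
    unfolding s2_def
  proof (rule For_invariant_eff)
    show "?I 0 s1"
      using count_degrees_correct[OF e c T] T card_mono[OF _ T]
      by (intro exI[of _ T]) (auto simp: s1_def)
  next
    fix i and t :: state
    assume i: "i < snd s1 0 0" and I: "?I i t"
      and fa: "\<And>A. A \<notin> warrs ?b \<Longrightarrow> snd t A = snd s1 A"
    have "snd t 0 = snd s 0" "snd t 2 = snd s 2" "snd t 3 = snd s 3"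
      using fa[of 0] fa[of 2] fa[of 3] by (auto simp: peel_frames s1)
    then have et: "envs (setr 2 i t)" using e by simp
    obtain C where C: "C \<subseteq> {..<n}" "chr n (snd (setr 2 i t) 5) C"
      "\<forall>w<n. snd (setr 2 i t) 6 w = card (C \<inter> nbs E w)" "dg T \<longleftrightarrow> dg C"
      "card C + i \<le> n \<or> (\<forall>w\<in>C. card (C \<inter> nbs E w) > k)" using I by auto
    let ?t = "eff (find_low k) (setr 2 i t)"
    have ft: "snd ?t = snd t" by (rule ext) (simp add: snd_eff peel_frames)
    note low = find_low_correct[OF et C(2,3,1)]
    have fC: "finite C" using C finite_subset by blast
    show "?I (Suc i) (eff ?b (setr 2 i t))"
    proof (cases "fst ?t 5 = 0")
      case True
      then show ?thesis using C low ft by (intro exI[of _ C]) auto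
    next
      case False
      then obtain u where u: "fst ?t 5 = Suc u" using not0_implies_Suc by blast
      then have uC: "u \<in> C" "card (C \<inter> nbs E u) \<le> k" using low by auto
      have "chr n (snd (eff remove_low ?t) 5) (C - {u})"
        "\<forall>w<n. snd (eff remove_low ?t) 6 w = card ((C - {u}) \<inter> nbs E w)"
        using remove_low_correct[of ?t C u] et C uC(1) u by (auto simp: ft)
      moreover have "card (C - {u}) + Suc i \<le> n"
      proof -
        have "card C + i \<le> n" using C(5) uC by (meson linorder_not_less)
        then show ?thesis using fC uC(1) by (simp add: card_gt_0_iff card_Diff_singleton_if) (metis Suc_pred card_gt_0_iff empty_iff add_Suc)
      qed
      ultimately show ?thesis
        using C False dg_iff_remove[OF uC(2) fC] by (intro exI[of _ "C - {u}"]) auto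
    qed
  qed (auto simp: peel_frames)
  then obtain C where C: "C \<subseteq> {..<n}" "chr n (snd s2 5) C" "dg T \<longleftrightarrow> dg C"
    "card C + n \<le> n \<or> (\<forall>w\<in>C. card (C \<inter> nbs E w) > k)"
    using e by (auto simp: s1 env_n)
  have fC: "finite C" using C finite_subset by blast
  have "dg C \<longleftrightarrow> C = {}"
  proof
    assume "dg C"
    show "C = {}"
    proof (rule ccontr)
      assume "C \<noteq> {}"
      with \<open>dg C\<close> obtain w where "w \<in> C" "card (C \<inter> nbs E w) \<le> k" unfolding degen_def by blast
      with C(4) fC \<open>C \<noteq> {}\<close> show False by (auto simp: card_eq_0_iff)
    qed
  qed simp
  moreover have "snd s2 0 = snd s 0" "snd s2 2 = snd s 2" "snd s2 3 = snd s 3"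
    unfolding s2_def by (subst snd_eff; simp add: peel_frames s1)+
  then have "fst (eff check_empty s2) 1 = of_bool (C = {})"
    using C e by (intro check_empty_correct) auto
  ultimately show ?thesis using C(3) by (simp add: peel_def s2_def s1_def)
qed

lemma check_isolated_correct:
  assumes e: "envs s" and c: "chr n (snd s 4) T" and T: "T \<subseteq> {..<n}" and v: "fst s 0 = v" "v < n"
  shows "fst (eff check_isolated s) 1 = of_bool (T \<inter> nbs E v = {})"
proof -
  let ?b = "PIf (And (Eq (Get 4 (Reg 2)) (Num 1)) (adj (Reg 2) (Reg 0))) (PAssign 1 (Num 0)) PSkip"
  let ?s = "setr 1 1 s"
  have "(\<lambda>i t. fst t 1 = of_bool (T \<inter> nbs E v \<inter> {..<i} = {})) (snd ?s 0 0) (eff (vertices 2 ?b) ?s)"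
  proof (rule For_invariant_eff)
    fix i and t :: state
    assume i: "i < snd ?s 0 0" and I: "fst t 1 = of_bool (T \<inter> nbs E v \<inter> {..<i} = {})"
      and fr: "\<And>y. y \<notin> insert 2 (wregs ?b) \<Longrightarrow> fst t y = fst ?s y"
      and fa: "\<And>A. A \<notin> warrs ?b \<Longrightarrow> snd t A = snd ?s A"
    have t: "fst t 0 = v" "snd t 2 = snd s 2" "snd t 3 = snd s 3" "snd t 4 = snd s 4"
      using fr[of 0] fa[of 2] fa[of 3] fa[of 4] v by auto
    have i: "i < n" using i e by (simp add: env_n)
    have "T \<inter> nbs E v \<inter> {..<Suc i} = (if i \<in> T \<inter> nbs E v then insert i (T \<inter> nbs E v \<inter> {..<i})
        else T \<inter> nbs E v \<inter> {..<i})"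
      by (auto simp: lessThan_Suc)
    then show "fst (eff ?b (setr 2 i t)) 1 = of_bool (T \<inter> nbs E v \<inter> {..<Suc i} = {})"
      using I i chr_eq_1[OF c i] env_adj[OF e i v(2)] by (simp add: t)
  qed auto
  moreover have "T \<inter> nbs E v \<inter> {..<n} = T \<inter> nbs E v" using T by auto
  ultimately show ?thesis by (simp add: check_isolated_def env_n[OF e])
qed

text \<open>For \<open>k = 0\<close> degeneracy is independence, and as \<open>T\<close> is already
  independent only edges at the new vertex can spoil it. This lets a linear test replace
  peeling.\<close>

lemma test_correct:
  assumes e: "envs s" and c: "chr n (snd s 4) (insert v T)" and T: "T \<subseteq> {..<n}" "dg T"
    and v: "fst s 0 = v" "v < n"
  shows "fst (eff (test k) s) 1 = of_bool (dg (insert v T))"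
proof (cases "k = 0")
  case True
  have fT: "finite T" using T finite_subset by blast
  have "dg (insert v T) \<longleftrightarrow> insert v T \<inter> nbs E v = {}"
  proof
    assume "insert v T \<inter> nbs E v = {}"
    then have 1: "card (insert v T \<inter> nbs E v) \<le> k" by (metis card.empty le0)
    have "dg (insert v T - {v})" by (rule degen_subset[OF T(2)]) auto
    from degen_insert[OF this 1] show "dg (insert v T)" using fT by simp
  next
    assume d: "dg (insert v T)"
    show "insert v T \<inter> nbs E v = {}"
    proof (rule ccontr)
      assume "insert v T \<inter> nbs E v \<noteq> {}"
      then obtain u where u: "u \<in> T" "{u, v} \<in> E" using no_loop by auto
      then have "{u, v} \<subseteq> insert v T" "{u, v} \<noteq> {}" by auto
      then obtain w where w: "w \<in> {u, v}" "card ({u, v} \<inter> nbs E w) \<le> k"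
        using d unfolding degen_def by blast
      then have "{u, v} \<inter> nbs E w = {}" using True by simp
      moreover have "{v, u} \<in> E" using u(2) by (simp add: insert_commute)
      ultimately show False using u(2) w(1) by blast
    qed
  qed
  then show ?thesis
    using check_isolated_correct[OF e c _ v] T v True by (simp add: test_def)
next
  case False
  then show ?thesis using peel_correct[OF e c] T v by (simp add: test_def)
qed

lemma greedy_correct:
  assumes e: "envs s" and c: "chr n (snd s 4) T" and T: "T \<subseteq> {..<n}" "dg T"
  shows "chr n (snd (eff (greedy k) s) 4) (completion T)"
proof -
  let ?b = "PStore 4 (Reg 0) (Num 1) ;; test k ;;
     PIf (Eq (Reg 1) (Num 0)) (PStore 4 (Reg 0) (Num 0)) PSkip"
  have "(\<lambda>i t. chr n (snd t 4) (completion_upto i T)) (snd s 0 0) (eff (vertices 0 ?b) s)"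
  proof (rule For_invariant_eff)
    fix i and t :: state
    assume i: "i < snd s 0 0" and I: "chr n (snd t 4) (completion_upto i T)"
      and fa: "\<And>A. A \<notin> warrs ?b \<Longrightarrow> snd t A = snd s A"
    have t: "snd t 0 = snd s 0" "snd t 2 = snd s 2" "snd t 3 = snd s 3"
      using fa[of 0] fa[of 2] fa[of 3] by (auto simp: notin_test)
    have i: "i < n" using i e by (simp add: env_n)
    let ?T = "completion_upto i T"
    have T': "?T \<subseteq> {..<n}" "dg ?T" using T i completion_upto_subset completion_upto_dg by auto
    let ?t = "eff (PStore 4 (Reg 0) (Num 1)) (setr 0 i t)"
    let ?u = "eff (test k) ?t"
    have 4: "chr n (snd ?t 4) (insert i ?T)" using chr_upd(1)[OF I] by simp
    have ok: "fst ?u 1 = of_bool (dg (insert i ?T))"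
      by (rule test_correct) (use e 4 T' i in \<open>auto simp: t\<close>)
    have u: "snd ?u 4 = snd ?t 4" by (intro snd_eff) (simp add: notin_test)
    have u0: "fst ?u 0 = i" by (simp add: fst_eff notin_test)
    have eq: "eff ?b (setr 0 i t) = eff (PIf (Eq (Reg 1) (Num 0)) (PStore 4 (Reg 0) (Num 0)) PSkip) ?u"
      by simp
    show "chr n (snd (eff ?b (setr 0 i t)) 4) (completion_upto (Suc i) T)"
    proof (cases "dg (insert i ?T)")
      case True
      then show ?thesis unfolding eq using ok 4 u by simp
    next
      case False
      \<comment> \<open>The vertices of the set built so far are tried as well. They pass the test,
        so clearing the cell after a refusal restores exactly the previous set.\<close>
      then have "i \<notin> ?T" using T'(2) by (metis insert_absorb)
      then show ?thesis unfolding eq using False ok chr_upd(2)[OF 4, of i] u u0 by simp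
    qed
  qed (use c in \<open>auto simp: frame_test notin_test\<close>)
  then show ?thesis by (simp add: greedy_def completion_def env_n[OF e])
qed

end

section \<open>Generating the neighbours of a solution\<close>

definition encode :: prog where
  "encode = PAssign 6 (Num 0) ;;
     vertices 2 (PIf (Eq (Get 4 (Reg 2)) (Num 1)) (PAssign 6 (Plus (Reg 6) (Get 2 (Reg 2)))) PSkip)"

text \<open>The queue of the solutions found so far is array 9, in which register 10 points to the next one
  to be processed and register 9 to the end. Array 8 marks the codes of its members.\<close>

definition visit :: prog where
  "visit = encode ;; PIf (Eq (Get 8 (Reg 6)) (Num 0))
     (PStore 8 (Reg 6) (Num 1) ;; PStore 9 (Reg 9) (Reg 6) ;; PAssign 9 (Plus (Reg 9) (Num 1))) PSkip"

text \<open>Without division, binary digits are read off from the highest down, by comparing with a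
  power of two and subtracting it. The loop counter ascends, so the vertex is
  \<open>n - (i + 1)\<close>.\<close>

abbreviation downwards :: aexp where
  "downwards \<equiv> Minus (Get 0 (Num 0)) (Plus (Reg 2) (Num 1))"

definition decode :: prog where
  "decode = PAssign 6 (Get 9 (Reg 10)) ;; PAssign 10 (Plus (Reg 10) (Num 1)) ;;
     vertices 2 (PIf (Less (Reg 6) (Get 2 downwards)) (PStore 7 downwards (Num 0))
       (PStore 7 downwards (Num 1) ;; PAssign 6 (Minus (Reg 6) (Get 2 downwards))))"

definition emit :: "nat \<Rightarrow> prog" where
  "emit A = vertices 2 (PIf (Eq (Get A (Reg 2)) (Num 1)) (PPut (Reg 2)) PSkip) ;; PEmit"

text \<open>Array 7 holds the current solution \<open>S\<close>, register 7 the new vertex and the registers from 12 on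
  the neighbours of it that are to be retained.\<close>

primrec restore :: "nat \<Rightarrow> prog" where
  "restore 0 = PSkip"
| "restore (Suc j) = restore j ;; PStore 4 (Reg (12 + j)) (Get 7 (Reg (12 + j)))"

text \<open>The writes follow the nesting of \<open>seed\<close>: neighbours are cleared, guessed
  vertices are copied back from \<open>S\<close>, and \<open>v\<close> is set last because a guess
  may have overwritten its cell.\<close>

definition plant :: "nat \<Rightarrow> prog" where
  "plant k = vertices 2 (PStore 4 (Reg 2) (Get 7 (Reg 2)) ;;
       PIf (adj (Reg 2) (Reg 7)) (PStore 4 (Reg 2) (Num 0)) PSkip) ;;
     restore k ;; PStore 4 (Reg 7) (Num 1)"

definition generate :: "nat \<Rightarrow> prog" where
  "generate k = plant k ;; greedy k"

text \<open>The loops use the registers from 13 on. Register 12 is excluded, as an end of an edge is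
  put there.\<close>

primrec nest :: "nat \<Rightarrow> prog \<Rightarrow> prog" where
  "nest 0 b = b"
| "nest (Suc j) b = vertices (12 + Suc j) (nest j b)"

text \<open>Either end of an edge may be the new vertex, hence the two halves. For
  \<open>k \<le> 1\<close> there is no inner loop, and for \<open>k = 0\<close> register 12 is not
  read by \<open>restore\<close>.\<close>

definition candidates :: "nat \<Rightarrow> prog \<Rightarrow> prog" where
  "candidates k b = PFor 8 (Suc 0)
     (PAssign 7 (edge_end 0) ;; PAssign 12 (edge_end (Suc 0)) ;; nest (k - 1) b ;;
      PAssign 7 (edge_end (Suc 0)) ;; PAssign 12 (edge_end 0) ;; nest (k - 1) b)"

section \<open>Frames and running times of neighbour generation\<close>

lemma frame_encode: "wregs encode = {2, 6}" "warrs encode = {}" "wf_prog encode" "silent encode"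
  by (auto simp: encode_def)

lemma frame_visit: "wregs visit = {2, 6, 9}" "warrs visit = {8, 9}" "wf_prog visit" "silent visit"
  by (auto simp: visit_def frame_encode)

lemma frame_decode: "wregs decode = {2, 6, 10}" "warrs decode = {7}" "wf_prog decode" "silent decode"
  by (auto simp: decode_def)

lemma frame_emit: "wregs (emit A) = {2}" "warrs (emit A) = {}" "wf_prog (emit A)"
  by (auto simp: emit_def)

lemma frame_restore: "wregs (restore j) = {}" "warrs (restore j) \<subseteq> {4}" "wf_prog (restore j)"
  "silent (restore j)"
  by (induction j) auto

lemma frame_generate: "wregs (generate k) \<subseteq> {0, 1, 2, 3, 5}" "warrs (generate k) \<subseteq> {4, 5, 6}"
  "wf_prog (generate k)" "silent (generate k)"
  using frame_restore[of k] frame_greedy[of k] by (auto simp: generate_def plant_def)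

lemmas notin_generate = frame_generate(1,2)[THEN contra_subsetD]

lemma frame_nest:
  assumes "wregs b \<subseteq> {..<12}" "wf_prog b"
  shows "wregs (nest j b) = wregs b \<union> {12<..12 + j}" "wf_prog (nest j b)"
proof -
  show *: "wregs (nest j b) = wregs b \<union> {12<..12 + j}" for j
    by (induction j) auto
  show "wf_prog (nest j b)"
    by (induction j) (use assms * in auto)
qed

lemma warrs_nest: "warrs (nest j b) = warrs b"
  by (induction j) auto

lemma silent_nest: "silent (nest j b) = silent b"
  by (induction j) auto

lemma ord_restore: "ord (restore j) 0 0"
  by (induction j) (auto intro!: ord_intros)

lemma ord_generate: "ord (generate k) 0 (if k = 0 then 2 else 3)"
proof -
  have "ord (plant k) 0 (Suc 0)"
    unfolding plant_def by (intro ord_intros ord_mono[OF ord_restore]) auto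
  then show ?thesis
    unfolding generate_def by (intro ord_Seq ord_greedy) (auto elim: ord_mono)
qed

lemma ord_nest: "ord b 0 i \<Longrightarrow> ord (nest j b) 0 (i + j)"
  by (induction j) (auto intro!: ord_intros)

text \<open>The origin of the exponent: \<open>k - 1\<close> inner loops around a cubic body give
  \<open>3 + (k - 1) = k + 2\<close>, and for \<open>k = 0\<close> the quadratic body alone gives 2.
  The loop over edges contributes the remaining factor.\<close>

lemma ord_candidates:
  assumes "ord b 0 (if k = 0 then 2 else 3)"
  shows "ord (candidates k b) 1 (k + 2)"
proof -
  have "ord (nest (k - 1) b) 0 (k + 2)"
    using ord_nest[OF assms, of "k - 1"] by (auto split: if_splits elim: ord_mono)
  then show ?thesis
    unfolding candidates_def One_nat_def by (intro ord_intros)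
qed

lemma ord_visit: "ord visit 0 1" and ord_decode: "ord decode 0 1" and ord_emit: "ord (emit A) 0 1"
  unfolding visit_def encode_def decode_def emit_def One_nat_def by (intro ord_intros)+

lemma Int_lessThan_Suc:
  "A \<inter> {..<Suc i} = (if i \<in> A then insert i (A \<inter> {..<i}) else A \<inter> {..<i})"
  by (auto simp: lessThan_Suc)

text \<open>Justifies reading digit \<open>j\<close> by a single comparison with
  \<open>2 ^ j\<close> once the higher digits are gone.\<close>

lemma set_encode_less: "set_encode (A \<inter> {..<j}) < 2 ^ j"
proof (induction j)
  case (Suc j)
  then show ?case by (simp add: Int_lessThan_Suc set_encode_insert)
qed simp

section \<open>Correctness of the queue and of neighbour generation\<close>

context vgraph
begin

lemma encode_correct:
  assumes e: "envs s" and c: "chr n (snd s 4) T" and T: "T \<subseteq> {..<n}"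
  shows "fst (eff encode s) 6 = set_encode T"
proof -
  let ?b = "PIf (Eq (Get 4 (Reg 2)) (Num 1)) (PAssign 6 (Plus (Reg 6) (Get 2 (Reg 2)))) PSkip"
  let ?s = "setr 6 0 s"
  have "(\<lambda>i t. fst t 6 = set_encode (T \<inter> {..<i})) (snd ?s 0 0) (eff (vertices 2 ?b) ?s)"
  proof (rule For_invariant_eff)
    fix i and t :: state
    assume i: "i < snd ?s 0 0" and I: "fst t 6 = set_encode (T \<inter> {..<i})"
      and fa: "\<And>A. A \<notin> warrs ?b \<Longrightarrow> snd t A = snd ?s A"
    have t: "snd t 4 = snd s 4" "snd t 2 = snd s 2" using fa[of 4] fa[of 2] by auto
    have i: "i < n" using i e by (simp add: env_n)
    show "fst (eff ?b (setr 2 i t)) 6 = set_encode (T \<inter> {..<Suc i})"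
      unfolding Int_lessThan_Suc using I i chr_eq_1[OF c i] e
      by (simp add: t set_encode_insert env_def)
  qed auto
  moreover have "T \<inter> {..<n} = T" using T by auto
  ultimately show ?thesis by (simp add: encode_def env_n[OF e])
qed

text \<open>\<open>Q\<close> is the whole history, since processed entries stay; so distinctness of
  \<open>Q\<close> means that no solution is ever enqueued twice. The marks are specified on all
  vertex sets, as a lookup precedes the insertion.\<close>

definition queue :: "nat set list \<Rightarrow> nat \<Rightarrow> (nat \<Rightarrow> nat) \<Rightarrow> (nat \<Rightarrow> nat) \<Rightarrow> bool" where
  "queue Q l f q \<longleftrightarrow> distinct Q \<and> set Q \<subseteq> Sol \<and> l = length Q \<and> (\<forall>i<length Q. q i = set_encode (Q ! i)) \<and>
     (\<forall>S\<subseteq>{..<n}. f (set_encode S) = of_bool (S \<in> set Q))"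

abbreviation queues :: "nat set list \<Rightarrow> state \<Rightarrow> bool" where
  "queues Q s \<equiv> queue Q (fst s 9) (snd s 8) (snd s 9)"

lemma set_encode_inj: "S \<subseteq> {..<n} \<Longrightarrow> T \<subseteq> {..<n} \<Longrightarrow> set_encode S = set_encode T \<longleftrightarrow> S = T"
  by (meson finite_lessThan finite_subset set_encode_eq)

lemma visit_correct:
  assumes e: "envs s" and c: "chr n (snd s 4) T" and T: "T \<in> Sol" and q: "queues Q s"
  shows "queues (if T \<in> set Q then Q else Q @ [T]) (eff visit s)"
proof -
  have Tn: "T \<subseteq> {..<n}" using T by (simp add: Sol_def)
  let ?t = "eff encode s"
  have 6: "fst ?t 6 = set_encode T" by (rule encode_correct[OF e c Tn])
  have t: "snd ?t = snd s" "fst ?t 9 = fst s 9"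
    by (auto simp: fst_eff snd_eff frame_encode)
  show ?thesis
  proof (cases "T \<in> set Q")
    case True
    then have "snd s 8 (set_encode T) = 1" using q Tn by (simp add: queue_def)
    then show ?thesis using q True by (simp add: visit_def 6 t)
  next
    case False
    then have "snd s 8 (set_encode T) = 0" using q Tn by (simp add: queue_def)
    then show ?thesis using q False Tn T
      by (auto simp: visit_def 6 t queue_def nth_append less_Suc_eq set_encode_inj)
  qed
qed

lemma decode_correct:
  assumes e: "envs s" and q: "queues Q s" and h: "fst s 10 = h" "h < length Q"
  shows "chr n (snd (eff decode s) 7) (Q ! h)" "fst (eff decode s) 10 = Suc h"
proof -
  let ?b = "PIf (Less (Reg 6) (Get 2 downwards)) (PStore 7 downwards (Num 0))
       (PStore 7 downwards (Num 1) ;; PAssign 6 (Minus (Reg 6) (Get 2 downwards)))"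
  let ?S = "Q ! h"
  let ?s = "setr 10 (Suc h) (setr 6 (set_encode ?S) s)"
  have "Q ! h \<in> Sol" using q h(2) by (auto simp: queue_def)
  then have S: "?S \<subseteq> {..<n}" by (simp add: Sol_def)
  have d: "eff decode s = eff (vertices 2 ?b) ?s"
    using q h by (simp add: decode_def queue_def)
  \<comment> \<open>After \<open>i\<close> rounds the top \<open>i\<close> vertices are decided, and
    register 6 retains the code of the rest.\<close>
  have "(\<lambda>i t. fst t 6 = set_encode (?S \<inter> {..<n - i}) \<and>
      (\<forall>w. n - i \<le> w \<longrightarrow> w < n \<longrightarrow> snd t 7 w = of_bool (w \<in> ?S))) (snd ?s 0 0) (eff (vertices 2 ?b) ?s)"
  proof (rule For_invariant_eff)
    fix i and t :: state
    assume i: "i < snd ?s 0 0" and I: "fst t 6 = set_encode (?S \<inter> {..<n - i}) \<and>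
        (\<forall>w. n - i \<le> w \<longrightarrow> w < n \<longrightarrow> snd t 7 w = of_bool (w \<in> ?S))"
      and fa: "\<And>A. A \<notin> warrs ?b \<Longrightarrow> snd t A = snd ?s A"
    have t: "snd t 0 = snd s 0" "snd t 2 = snd s 2" using fa[of 0] fa[of 2] by auto
    have i: "i < n" using i e by (simp add: env_n)
    define j where "j = n - Suc i"
    have j: "n - i = Suc j" "j < n" "n - Suc i = j" using i by (auto simp: j_def)
    have p: "snd s 2 j = 2 ^ j" "snd s 0 0 = n" using e j by (auto simp: env_def)
    have le: "j \<le> w \<longleftrightarrow> w = j \<or> Suc j \<le> w" for w by auto
    have enc: "set_encode (?S \<inter> {..<Suc j}) =
        (if j \<in> ?S then 2 ^ j + set_encode (?S \<inter> {..<j}) else set_encode (?S \<inter> {..<j}))"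
      by (simp add: Int_lessThan_Suc set_encode_insert)
    show "fst (eff ?b (setr 2 i t)) 6 = set_encode (?S \<inter> {..<n - Suc i}) \<and>
        (\<forall>w. n - Suc i \<le> w \<longrightarrow> w < n \<longrightarrow> snd (eff ?b (setr 2 i t)) 7 w = of_bool (w \<in> ?S))"
      using I set_encode_less[of ?S j] unfolding j enc
      by (auto simp: t p j le)
  next
    show "fst ?s 6 = set_encode (?S \<inter> {..<n - 0}) \<and>
      (\<forall>w. n - 0 \<le> w \<longrightarrow> w < n \<longrightarrow> snd ?s 7 w = of_bool (w \<in> ?S))"
      using S by (simp add: Int_absorb2)
  qed auto
  then show "chr n (snd (eff decode s) 7) ?S" unfolding d by (simp add: chr_def env_n[OF e])
  show "fst (eff decode s) 10 = Suc h" unfolding d by (simp add: fst_eff)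
qed

lemma emit_correct:
  assumes e: "envs s" and c: "chr n (snd s A) T" and T: "T \<subseteq> {..<n}"
  obtains ws where "outs (emit A) s = map Elem ws @ [Output]" "set ws = T"
proof -
  let ?b = "PIf (Eq (Get A (Reg 2)) (Num 1)) (PPut (Reg 2)) PSkip"
  have "(\<lambda>i es t. \<exists>ws. es = map Elem ws \<and> set ws = T \<inter> {..<i})
    (snd s 0 0) (outs (vertices 2 ?b) s) (eff (vertices 2 ?b) s)"
  proof (rule For_invariant)
    fix i es and t :: state
    assume i: "i < snd s 0 0" and I: "\<exists>ws. es = map Elem ws \<and> set ws = T \<inter> {..<i}"
      and fa: "\<And>A. A \<notin> warrs ?b \<Longrightarrow> snd t A = snd s A"
    have t: "snd t A = snd s A" using fa by auto
    have i: "i < n" using i e by (simp add: env_n)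
    obtain ws where ws: "es = map Elem ws" "set ws = T \<inter> {..<i}" using I by blast
    show "\<exists>ws. es @ outs ?b (setr 2 i t) = map Elem ws \<and> set ws = T \<inter> {..<Suc i}"
      by (rule exI[of _ "if i \<in> T then ws @ [i] else ws"])
        (use ws chr_eq_1[OF c i] in \<open>auto simp: t Int_lessThan_Suc\<close>)
  qed auto
  moreover have "T \<inter> {..<n} = T" using T by auto
  ultimately show ?thesis using that by (auto simp: emit_def env_n[OF e])
qed

lemma restore_effect:
  "snd (eff (restore j) s) 4 =
    (\<lambda>w. if w \<in> (\<lambda>i. fst s (12 + i)) ` {..<j} then snd s 7 w else snd s 4 w)"
proof (induction j)
  case (Suc j)
  have "snd (eff (restore j) s) 7 = snd s 7"
    using frame_restore(2)[of j] by (intro snd_eff) auto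
  then show ?case using Suc by (auto simp: fst_eff frame_restore lessThan_Suc fun_eq_iff)
qed simp

lemma plant_correct:
  assumes e: "envs s" and c: "chr n (snd s 7) S" and v: "fst s 7 = v" "v < n"
  shows "chr n (snd (eff (plant k) s) 4) (seed S v (\<lambda>i. fst s (12 + i)))"
proof -
  let ?b = "PStore 4 (Reg 2) (Get 7 (Reg 2)) ;;
       PIf (adj (Reg 2) (Reg 7)) (PStore 4 (Reg 2) (Num 0)) PSkip"
  define t where "t = eff (vertices 2 ?b) s"
  have "(\<lambda>i t. \<forall>w<i. snd t 4 w = of_bool (w \<in> S - nbs E v)) (snd s 0 0) t"
    unfolding t_def
  proof (rule For_invariant_eff)
    fix i and t :: state
    assume i: "i < snd s 0 0" and I: "\<forall>w<i. snd t 4 w = of_bool (w \<in> S - nbs E v)"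
      and fr: "\<And>y. y \<notin> insert 2 (wregs ?b) \<Longrightarrow> fst t y = fst s y"
      and fa: "\<And>A. A \<notin> warrs ?b \<Longrightarrow> snd t A = snd s A"
    have t: "fst t 7 = v" "snd t 2 = snd s 2" "snd t 3 = snd s 3" "snd t 7 = snd s 7"
      using fr[of 7] fa[of 2] fa[of 3] fa[of 7] v by auto
    have i: "i < n" using i e by (simp add: env_n)
    show "\<forall>w<Suc i. snd (eff ?b (setr 2 i t)) 4 w = of_bool (w \<in> S - nbs E v)"
      using I c i env_adj[OF e i v(2)] by (auto simp: t less_Suc_eq chr_def)
  qed auto
  then have 4: "\<forall>w<n. snd t 4 w = of_bool (w \<in> S - nbs E v)" by (simp add: env_n[OF e])
  have t: "fst t (12 + i) = fst s (12 + i)" "fst t 7 = v" "snd t 7 = snd s 7" for i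
    using v by (simp_all add: t_def fst_eff snd_eff)
  have "eff (plant k) s = eff (PStore 4 (Reg 7) (Num 1)) (eff (restore k) t)"
    by (simp add: plant_def t_def)
  then have "snd (eff (plant k) s) 4 = (snd (eff (restore k) t) 4)(v := 1)"
    by (simp add: fst_eff frame_restore t)
  then show ?thesis
    using 4 c unfolding restore_effect t by (auto simp: chr_def seed_def)
qed

lemma generate_correct:
  assumes e: "envs s" and c: "chr n (snd s 7) S" and S: "S \<in> Sol" and v: "fst s 7 < n"
  shows "chr n (snd (eff (generate k) s) 4) (cand S (fst s 7) (\<lambda>i. fst s (12 + i)))"
proof -
  have S': "S \<subseteq> {..<n}" "dg S" "finite S" using S Sol_finite by (auto simp: Sol_def)
  have "0 \<notin> warrs (plant k)" "2 \<notin> warrs (plant k)" "3 \<notin> warrs (plant k)"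
    using frame_restore(2)[of k] by (auto simp: plant_def)
  then have "envs (eff (plant k) s)" using e by (simp add: snd_eff)
  then show ?thesis
    unfolding generate_def eff.simps
    by (intro greedy_correct plant_correct e c v seed_subset seed_dg S') auto
qed

primrec results :: "nat \<Rightarrow> nat set \<Rightarrow> nat \<Rightarrow> (nat \<Rightarrow> nat) \<Rightarrow> nat set set" where
  "results 0 S v L = {cand S v L}"
| "results (Suc j) S v L = (\<Union>x<n. results j S v (L(Suc j := x)))"

text \<open>The loops overwrite the entries 1 to \<open>j\<close>, so values left in their registers
  by earlier rounds are irrelevant.\<close>

lemma results_cong:
  "(\<And>i. i \<notin> {0<..j} \<Longrightarrow> L i = M i) \<Longrightarrow> results j S v L = results j S v M"
proof (induction j arbitrary: L M)
  case 0
  then have "L = M" by auto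
  then show ?case by simp
next
  case (Suc j)
  have "results j S v (L(Suc j := x)) = results j S v (M(Suc j := x))" for x
    by (rule Suc.IH) (use Suc.prems in auto)
  then show ?case by simp
qed

lemma results_eq:
  "results j S v L =
    {cand S v M | M. (\<forall>i\<in>{0<..j}. M i < n) \<and> (\<forall>i. i \<notin> {0<..j} \<longrightarrow> M i = L i)}"
proof (induction j arbitrary: L)
  case 0
  have "(\<forall>i. M i = L i) \<longleftrightarrow> M = L" for M by auto
  then show ?case by simp
next
  case (Suc j)
  have *: "(\<exists>x<n. (\<forall>i\<in>{0<..j}. M i < n) \<and> (\<forall>i. i \<notin> {0<..j} \<longrightarrow> M i = (L(Suc j := x)) i)) \<longleftrightarrow>
      (\<forall>i\<in>{0<..Suc j}. M i < n) \<and> (\<forall>i. i \<notin> {0<..Suc j} \<longrightarrow> M i = L i)" (is "?l = ?r") for M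
  proof
    assume ?l
    then obtain x where x: "x < n" "\<forall>i\<in>{0<..j}. M i < n"
      "\<And>i. i \<notin> {0<..j} \<Longrightarrow> M i = (L(Suc j := x)) i" by blast
    have "M (Suc j) = x" using x(3)[of "Suc j"] by simp
    then show ?r using x by (auto simp: le_Suc_eq)
  next
    assume ?r
    then show ?l by (intro exI[of _ "M (Suc j)"]) (auto simp: le_Suc_eq)
  qed
  have "results (Suc j) S v L =
      {cand S v M | M. \<exists>x<n. (\<forall>i\<in>{0<..j}. M i < n) \<and> (\<forall>i. i \<notin> {0<..j} \<longrightarrow> M i = (L(Suc j := x)) i)}"
    unfolding results.simps Suc.IH by blast
  then show ?case unfolding * .
qed

definition edge_results :: "nat set \<Rightarrow> nat \<Rightarrow> nat \<Rightarrow> nat set set" where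
  "edge_results S v x = {cand S v L | L. L 0 = x \<and> (\<forall>i. 0 < i \<longrightarrow> i < k \<longrightarrow> L i < n)}"

text \<open>From index \<open>k\<close> on the registers hold arbitrary values, whereas a guess is
  free there. The two sides agree because \<open>seed\<close> only looks at the entries below
  \<open>k\<close>.\<close>

lemma results_edge: "L 0 = x \<Longrightarrow> results (k - 1) S v L = edge_results S v x"
proof -
  assume L: "L 0 = x"
  have "\<exists>M'. cand S v M = cand S v M' \<and>
      (\<forall>i\<in>{0<..k - 1}. M' i < n) \<and> (\<forall>i. i \<notin> {0<..k - 1} \<longrightarrow> M' i = L i)"
    if "M 0 = x" "\<forall>i. 0 < i \<longrightarrow> i < k \<longrightarrow> M i < n" for M
  proof -
    let ?M = "\<lambda>i. if i < k then M i else L i"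
    have "?M ` {..<k} = M ` {..<k}" by auto
    then have "seed S v M = seed S v ?M" by (simp add: seed_def)
    then show ?thesis using that L by (intro exI[of _ ?M]) auto
  qed
  moreover have "M 0 = x \<and> (\<forall>i. 0 < i \<longrightarrow> i < k \<longrightarrow> M i < n)"
    if "\<forall>i\<in>{0<..k - 1}. M i < n" "\<forall>i. i \<notin> {0<..k - 1} \<longrightarrow> M i = L i" for M
    using that L by auto
  ultimately show ?thesis unfolding results_eq edge_results_def by blast
qed

lemma nbrs_eq: "nbrs S = (\<Union>(v, x)\<in>{(v, x). {v, x} \<in> E}. edge_results S v x)"
  by (auto simp: nbrs_def edge_results_def)

text \<open>The invariant \<open>J\<close> is a parameter because the same loops serve two bodies,
  one printing each candidate and one enqueuing it. \<open>X\<close> collects the candidates met so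
  far, \<open>es\<close> the events.\<close>

lemma nest_invariant:
  assumes b: "wf_prog b" "wregs b \<subseteq> {..<12}" "7 \<notin> wregs b"
    and body: "\<And>X es t. J X es t \<Longrightarrow> fst t 7 = v \<Longrightarrow>
      J (insert (cand S v (\<lambda>i. fst t (12 + i))) X) (es @ outs b t) (eff b t)"
    and Jreg: "\<And>X es t y a. 12 \<le> y \<Longrightarrow> J X es t \<Longrightarrow> J X es (setr y a t)"
    and Jn: "\<And>X es t. J X es t \<Longrightarrow> snd t 0 0 = n"
  shows "J X es t \<Longrightarrow> fst t 7 = v \<Longrightarrow>
    J (X \<union> results j S v (\<lambda>i. fst t (12 + i))) (es @ outs (nest j b) t) (eff (nest j b) t)"
proof (induction j arbitrary: X es t)
  case 0
  then show ?case using body by (simp add: insert_commute)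
next
  case (Suc j)
  let ?x = "12 + Suc j"
  let ?L = "\<lambda>i. fst t (12 + i)"
  have "(\<lambda>i es' t'. J (X \<union> (\<Union>x<i. results j S v (?L(Suc j := x)))) (es @ es') t')
    (snd t 0 0) (outs (vertices ?x (nest j b)) t) (eff (vertices ?x (nest j b)) t)"
  proof (rule For_invariant)
    show "wf_prog (vertices ?x (nest j b))" using b by (auto simp: frame_nest)
    show "J (X \<union> (\<Union>x<0. results j S v (?L(Suc j := x)))) (es @ []) t" using Suc.prems by simp
  next
    fix i es' and t' :: state
    assume I: "J (X \<union> (\<Union>x<i. results j S v (?L(Suc j := x)))) (es @ es') t'"
      and fr: "\<And>y. y \<notin> insert ?x (wregs (nest j b)) \<Longrightarrow> fst t' y = fst t y"
    let ?t = "setr ?x i t'"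
    have t': "fst t' y = fst t y" if "y = 7 \<or> (12 \<le> y \<and> y - 12 \<notin> {0<..Suc j})" for y
      using that b by (intro fr) (auto simp: frame_nest)
    have "results j S v (\<lambda>i. fst ?t (12 + i)) = results j S v (?L(Suc j := i))"
      by (rule results_cong) (auto simp: t')
    moreover have "fst ?t 7 = v" using Suc.prems(2) t'[of 7] by simp
    ultimately show "J (X \<union> (\<Union>x<Suc i. results j S v (?L(Suc j := x))))
        (es @ es' @ outs (nest j b) ?t) (eff (nest j b) ?t)"
      using Suc.IH[of "X \<union> (\<Union>x<i. results j S v (?L(Suc j := x)))" "es @ es'" ?t] Jreg[OF _ I, of ?x i]
      by (simp add: lessThan_Suc Un_ac)
  next
    fix es' and t' :: state and a
    assume "J (X \<union> (\<Union>x<snd t 0 0. results j S v (?L(Suc j := x)))) (es @ es') t'"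
    then show "J (X \<union> (\<Union>x<snd t 0 0. results j S v (?L(Suc j := x)))) (es @ es') (setr ?x a t')"
      by (intro Jreg) auto
  qed
  then show ?case using Jn[OF Suc.prems(1)] by simp
qed

lemma candidates_invariant:
  assumes b: "wf_prog b" "wregs b \<subseteq> {..<12}" "7 \<notin> wregs b" "8 \<notin> wregs b" "0 \<notin> warrs b"
    and body: "\<And>X es t. J X es t \<Longrightarrow> fst t 7 < n \<Longrightarrow>
      J (insert (cand S (fst t 7) (\<lambda>i. fst t (12 + i))) X) (es @ outs b t) (eff b t)"
    and Jreg: "\<And>X es t y a. y = 7 \<or> y = 8 \<or> 12 \<le> y \<Longrightarrow> J X es t \<Longrightarrow> J X es (setr y a t)"
    and Jenv: "\<And>X es t. J X es t \<Longrightarrow> envs t"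
    and J: "J X es s"
  shows "J (X \<union> nbrs S) (es @ outs (candidates k b) s) (eff (candidates k b) s)"
proof -
  have step: "J (X \<union> edge_results S v x) (es @ outs (nest (k - 1) b) t) (eff (nest (k - 1) b) t)"
    if "J X es t" "fst t 7 = v" "fst t 12 = x" "v < n" for X es t v x
  proof -
    have "J (X \<union> results (k - 1) S v (\<lambda>i. fst t (12 + i))) (es @ outs (nest (k - 1) b) t)
        (eff (nest (k - 1) b) t)"
      by (rule nest_invariant[of b J v S]) (use b body Jreg env_n[OF Jenv] that in auto)
    moreover have "results (k - 1) S v (\<lambda>i. fst t (12 + i)) = edge_results S v x"
      by (rule results_edge) (use that in simp)
    ultimately show ?thesis by simp
  qed
  let ?n = "nest (k - 1) b"
  let ?b = "PAssign 7 (edge_end 0) ;; PAssign 12 (edge_end (Suc 0)) ;; ?n ;;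
      PAssign 7 (edge_end (Suc 0)) ;; PAssign 12 (edge_end 0) ;; ?n"
  let ?a = "\<lambda>i. snd s 0 (i + i + 2)" and ?c = "\<lambda>i. snd s 0 (i + i + 3)"
  let ?N = "\<lambda>i. edge_results S (?a i) (?c i) \<union> edge_results S (?c i) (?a i)"
  have E: "(\<lambda>i. {?a i, ?c i}) ` {..<snd s 0 1} = E" using Jenv[OF J] by (simp add: env_def)
  have "(\<lambda>i es' t. J (X \<union> (\<Union>l<i. ?N l)) (es @ es') t)
    (snd s 0 (Suc 0)) (outs (PFor 8 (Suc 0) ?b) s) (eff (PFor 8 (Suc 0) ?b) s)"
  proof (rule For_invariant)
    show "wf_prog (PFor 8 (Suc 0) ?b)" using b by (auto simp: frame_nest)
    show "J (X \<union> (\<Union>l<0. ?N l)) (es @ []) s" using J by simp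
  next
    fix i es' and t :: state
    assume i: "i < snd s 0 (Suc 0)" and I: "J (X \<union> (\<Union>l<i. ?N l)) (es @ es') t"
      and fa: "\<And>A. A \<notin> warrs ?b \<Longrightarrow> snd t A = snd s A"
    have t: "snd t 0 = snd s 0" using fa[of 0] b by (simp add: warrs_nest)
    have "{?a i, ?c i} \<in> E" using E i by auto
    then have ac: "?a i < n" "?c i < n" using edge_less by blast+
    let ?t = "setr 12 (?c i) (setr 7 (?a i) (setr 8 i t))"
    let ?u = "eff ?n ?t"
    let ?t' = "setr 12 (?a i) (setr 7 (?c i) ?u)"
    have u: "fst ?u 8 = i" "snd ?u 0 = snd s 0"
      using b t by (auto simp: fst_eff snd_eff frame_nest warrs_nest)
    have eq: "eff ?b (setr 8 i t) = eff ?n ?t'" "outs ?b (setr 8 i t) = outs ?n ?t @ outs ?n ?t'"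
      using u by (simp_all add: t)
    have "J (X \<union> (\<Union>l<i. ?N l)) (es @ es') ?t"
      by (intro Jreg I) auto
    from step[OF this _ _ ac(1)]
    have "J (X \<union> (\<Union>l<i. ?N l) \<union> edge_results S (?a i) (?c i)) ((es @ es') @ outs ?n ?t) ?u"
      by simp
    then have "J (X \<union> (\<Union>l<i. ?N l) \<union> edge_results S (?a i) (?c i)) ((es @ es') @ outs ?n ?t) ?t'"
      by (intro Jreg) auto
    from step[OF this _ _ ac(2)]
    show "J (X \<union> (\<Union>l<Suc i. ?N l)) (es @ es' @ outs ?b (setr 8 i t)) (eff ?b (setr 8 i t))"
      unfolding eq by (simp add: lessThan_Suc Un_ac)
  next
    fix es' and t :: state and a
    assume "J (X \<union> (\<Union>l<snd s 0 (Suc 0). ?N l)) (es @ es') t"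
    then show "J (X \<union> (\<Union>l<snd s 0 (Suc 0). ?N l)) (es @ es') (setr 8 a t)"
      by (intro Jreg) auto
  qed
  moreover have "(\<Union>l<snd s 0 (Suc 0). ?N l) = nbrs S"
    unfolding nbrs_eq
  proof (intro subset_antisym subsetI)
    fix T assume "T \<in> (\<Union>l<snd s 0 (Suc 0). ?N l)"
    then obtain l where l: "l < snd s 0 1" "T \<in> ?N l" by auto
    then have "{?a l, ?c l} \<in> E" "{?c l, ?a l} \<in> E" using E by (auto simp: insert_commute)
    then show "T \<in> (\<Union>(v, x)\<in>{(v, x). {v, x} \<in> E}. edge_results S v x)" using l(2) by blast
  next
    fix T assume "T \<in> (\<Union>(v, x)\<in>{(v, x). {v, x} \<in> E}. edge_results S v x)"
    then obtain v x where vx: "{v, x} \<in> E" "T \<in> edge_results S v x" by blast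
    then obtain l where l: "l < snd s 0 1" "{v, x} = {?a l, ?c l}" using E by (metis (no_types, lifting) imageE lessThan_iff)
    then have "T \<in> ?N l" using vx(2) by (auto simp: doubleton_eq_iff)
    then show "T \<in> (\<Union>l<snd s 0 (Suc 0). ?N l)" using l(1) by auto
  qed
  ultimately show ?thesis by (simp add: candidates_def)
qed

end

section \<open>Runs of the three programs\<close>

definition first_solution :: "nat \<Rightarrow> prog" where
  "first_solution k = prepare ;; greedy k ;; emit 4"

text \<open>Loop bounds must be cells of array 0, so the given set is read by a loop over all
  vertices with a guard on its length. Repeated outputs are harmless here, as only the set of
  outputs is specified.\<close>

definition list_neighbors :: "nat \<Rightarrow> prog" where
  "list_neighbors k = prepare ;;
     vertices 2 (PIf (Less (Reg 2) (Get 1 (Num 0)))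
       (PStore 7 (Get 1 (Plus (Reg 2) (Num 1))) (Num 1)) PSkip) ;;
     candidates k (generate k ;; emit 4)"

definition start :: "nat \<Rightarrow> prog" where
  "start k = prepare ;; greedy k ;; visit"

definition process :: "nat \<Rightarrow> prog" where
  "process k = decode ;; emit 7 ;; candidates k (generate k ;; visit)"

text \<open>The number of rounds depends on the number of solutions, which no input cell bounds. So
  this loop lies outside \<open>prog\<close> and its run is built by hand.\<close>

definition enumerate_all :: "nat \<Rightarrow> com" where
  "enumerate_all k = Seq (compile (start k)) (While (Less (Reg 10) (Reg 9)) (compile (process k)))"

lemmas notin_all = notin_greedy notin_generate
lemmas frame_all = frame_prepare frame_greedy(3,4) frame_visit frame_decode frame_emit frame_generate(3,4)

lemma wf_candidates:
  "wf_prog b \<Longrightarrow> wregs b \<subseteq> {..<12} \<Longrightarrow> 8 \<notin> wregs b \<Longrightarrow> wf_prog (candidates k b)"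
  by (auto simp: candidates_def frame_nest)

lemma silent_candidates: "silent (candidates k b) = silent b"
  by (simp add: candidates_def silent_nest)

lemma wregs_generate_bound: "wregs (generate k) \<subseteq> {..<12}"
  using frame_generate(1)[of k] by auto

lemma wf_programs: "wf_prog (first_solution k)" "wf_prog (list_neighbors k)" "wf_prog (start k)"
  "wf_prog (process k)"
  using wregs_generate_bound[of k]
  by (auto simp: first_solution_def list_neighbors_def start_def process_def frame_all
      notin_all intro!: wf_candidates)

lemma ord_programs: "ord (first_solution k) 1 (k + 2)" "ord (list_neighbors k) 1 (k + 2)"
  "ord (start k) 1 (k + 2)" "ord (process k) 1 (k + 2)"
proof -
  have k: "(if k = 0 then 2 else 3) \<le> k + 2" by simp
  have 1: "ord prepare 1 (k + 2)" "ord (greedy k) 1 (k + 2)" "ord visit 1 (k + 2)"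
    "ord decode 1 (k + 2)" "ord (emit A) 1 (k + 2)" for A
    using k by (auto intro: ord_mono[OF ord_prepare] ord_mono[OF ord_greedy] ord_mono[OF ord_visit]
        ord_mono[OF ord_decode] ord_mono[OF ord_emit])
  have 2: "ord (generate k ;; emit A) 0 (if k = 0 then 2 else 3)"
    "ord (generate k ;; visit) 0 (if k = 0 then 2 else 3)" for A
    by (intro ord_Seq ord_generate ord_mono[OF ord_emit] ord_mono[OF ord_visit]; simp)+
  have 3: "ord (vertices 2 (PIf (Less (Reg 2) (Get 1 (Num 0)))
       (PStore 7 (Get 1 (Plus (Reg 2) (Num 1))) (Num 1)) PSkip)) 1 (k + 2)"
    by (rule ord_mono[where i = 0 and j = "Suc 0"]) (auto intro!: ord_intros)
  show "ord (first_solution k) 1 (k + 2)" "ord (list_neighbors k) 1 (k + 2)"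
    "ord (start k) 1 (k + 2)" "ord (process k) 1 (k + 2)"
    unfolding first_solution_def list_neighbors_def start_def process_def
    by (intro ord_Seq ord_candidates 1 2 3)+
qed

section \<open>Outputs and gaps of traces\<close>

lemma outputs_nonstep: "outputs_from A (nonstep tr) = outputs_from A tr"
proof (induction tr arbitrary: A)
  case (Cons e tr)
  then show ?case by (cases e) auto
qed simp

lemma outputs_nonstep_eq: "nonstep tr = es \<Longrightarrow> outputs tr = outputs es"
  using outputs_nonstep by (auto simp: outputs_def)

lemma outputs_emit:
  "outputs_from A (map Elem ws @ Output # tr) = (A \<union> set ws) # outputs_from {} tr"
  by (induction ws arbitrary: A) auto

lemma gaps_from_nonempty: "gaps_from a tr \<noteq> []"
proof (induction tr arbitrary: a)
  case (Cons e tr)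
  then show ?case by (cases e) auto
qed simp

text \<open>The last period of \<open>tr\<close> is still open, so its length is where counting
  resumes in \<open>tr'\<close>.\<close>

lemma gaps_from_append:
  "gaps_from a (tr @ tr') = butlast (gaps_from a tr) @ gaps_from (last (gaps_from a tr)) tr'"
proof (induction tr arbitrary: a)
  case (Cons e tr)
  then show ?case using gaps_from_nonempty by (cases e) auto
qed simp

lemma gaps_from_le: "g \<in> set (gaps_from a tr) \<Longrightarrow> g \<le> a + length tr"
proof (induction tr arbitrary: a)
  case (Cons e tr)
  then show ?case
    by (cases e) (fastforce dest: Cons.IH)+
qed simp

text \<open>An output resets the counter, so the initial value \<open>a\<close> drops out. This
  stops time from accumulating over the rounds of the search.\<close>

lemma last_gap_le:
  "outputs_from A tr \<noteq> [] \<Longrightarrow> last (gaps_from a tr) \<le> length tr"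
proof (induction tr arbitrary: a A)
  case (Cons e tr)
  show ?case
  proof (cases e)
    case Output
    have "last (gaps_from 0 tr) \<le> length tr"
      using gaps_from_le[of _ 0 tr] gaps_from_nonempty last_in_set by fastforce
    then show ?thesis using Output gaps_from_nonempty by simp
  qed (use Cons.prems in \<open>auto intro: le_SucI Cons.IH\<close>)
qed simp

section \<open>Correctness and delay of the three programs\<close>

context vgraph
begin

abbreviation input :: "state \<Rightarrow> bool" where
  "input s \<equiv> snd s 0 0 = n \<and> (\<lambda>i. {snd s 0 (i + i + 2), snd s 0 (i + i + 3)}) ` {..<snd s 0 1} = E \<and>
     snd s 3 = (\<lambda>_. 0) \<and> snd s 4 = (\<lambda>_. 0)"

lemma greedy_empty:
  assumes "input s"
  defines "t \<equiv> eff (prepare ;; greedy k) s"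
  shows "envs t" "chr n (snd t 4) (completion {})"
    and "y \<notin> {0, 1, 2, 3, 5, 6, 8} \<Longrightarrow> fst t y = fst s y"
    and "A \<notin> {2, 3, 4, 5, 6} \<Longrightarrow> snd t A = snd s A"
proof -
  let ?s = "eff prepare s"
  have e: "envs ?s" using assms by (intro prepare_correct) auto
  have "chr n (snd ?s 4) {}" using assms by (simp add: snd_eff frame_prepare chr_def)
  from greedy_correct[OF e this] show "chr n (snd t 4) (completion {})" by (simp add: t_def)
  show "envs t" using e by (simp add: t_def snd_eff notin_greedy)
  show "y \<notin> {0, 1, 2, 3, 5, 6, 8} \<Longrightarrow> fst t y = fst s y"
    by (simp add: t_def fst_eff notin_greedy frame_prepare)
  show "A \<notin> {2, 3, 4, 5, 6} \<Longrightarrow> snd t A = snd s A"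
    by (simp add: t_def snd_eff notin_greedy frame_prepare)
qed

lemma completion_empty_Sol: "completion {} \<in> Sol"
  by (rule completion_Sol) auto

lemma Sol_subset: "S \<in> Sol \<Longrightarrow> S \<subseteq> {..<n}"
  by (simp add: Sol_def)

lemma first_solution_outputs:
  assumes "input s"
  shows "outputs (outs (first_solution k) s) = [completion {}]"
proof -
  let ?t = "eff (prepare ;; greedy k) s"
  obtain ws where "outs (emit 4) ?t = map Elem ws @ [Output]" "set ws = completion {}"
    using emit_correct[OF greedy_empty(1,2)[OF assms] Sol_subset[OF completion_empty_Sol]] .
  then show ?thesis
    by (simp add: first_solution_def outs_silent frame_all outputs_def outputs_emit)
qed

lemma list_neighbors_outputs:
  assumes i: "input s" and S: "S \<in> Sol" and z: "snd s 7 = (\<lambda>_. 0)"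
    and c: "snd s 1 0 = length vs" "\<And>i. i < length vs \<Longrightarrow> snd s 1 (Suc i) = vs ! i"
      "set vs = S" "distinct vs"
  shows "set (outputs (outs (list_neighbors k) s)) = nbrs S"
proof -
  let ?b = "PIf (Less (Reg 2) (Get 1 (Num 0)))
       (PStore 7 (Get 1 (Plus (Reg 2) (Num 1))) (Num 1)) PSkip"
  let ?c = "generate k ;; emit 4"
  define t where "t = eff prepare s"
  define u where "u = eff (vertices 2 ?b) t"
  have et: "envs t" unfolding t_def using i by (intro prepare_correct) auto
  have t: "snd t 1 = snd s 1" "snd t 7 = (\<lambda>_. 0)"
    using z by (simp_all add: t_def snd_eff frame_prepare)
  have n: "length vs \<le> n"
    using c(3,4) card_mono[OF _ Sol_subset[OF S]] by (simp add: distinct_card[symmetric])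
  have "(\<lambda>i t. snd t 7 = (\<lambda>w. of_bool (w \<in> set (take i vs)))) (snd t 0 0) u"
    unfolding u_def
  proof (rule For_invariant_eff)
    fix i and t' :: state
    assume I: "snd t' 7 = (\<lambda>w. of_bool (w \<in> set (take i vs)))"
      and fa: "\<And>A. A \<notin> warrs ?b \<Longrightarrow> snd t' A = snd t A"
    have t': "snd t' (Suc 0) = snd s (Suc 0)" using fa[of 1] t by simp
    show "snd (eff ?b (setr 2 i t')) 7 = (\<lambda>w. of_bool (w \<in> set (take (Suc i) vs)))"
    proof (cases "i < length vs")
      case True
      then show ?thesis using I c(1,2) by (auto simp: t' take_Suc_conv_app_nth fun_eq_iff)
    qed (use I c(1) in \<open>simp add: t'\<close>)
  qed (use t in auto)
  then have 7: "chr n (snd u 7) S" using n c(3) by (simp add: chr_def env_n[OF et])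
  have eu: "envs u" using et by (simp add: u_def snd_eff)
  \<comment> \<open>The last conjunct says that \<open>es\<close> leaves no partially written set
    behind, so that later outputs are unaffected by it.\<close>
  let ?J = "\<lambda>X es t. envs t \<and> chr n (snd t 7) S \<and> set (outputs es) = X \<and>
    (\<forall>tr. outputs (es @ tr) = outputs es @ outputs tr)"
  have "?J ({} \<union> nbrs S) ([] @ outs (candidates k ?c) u) (eff (candidates k ?c) u)"
  proof (rule candidates_invariant)
    fix X and es :: "event list" and t :: state
    assume J: "?J X es t" and v: "fst t 7 < n"
    let ?t = "eff (generate k) t" and ?T = "cand S (fst t 7) (\<lambda>i. fst t (12 + i))"
    have T: "chr n (snd ?t 4) ?T" by (rule generate_correct) (use J S v in auto)
    have et: "envs ?t" using J by (simp add: snd_eff notin_generate)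
    obtain ws where ws: "outs (emit 4) ?t = map Elem ws @ [Output]" "set ws = ?T"
      using emit_correct[OF et T Sol_subset[OF cand_Sol[OF S v]]] .
    have o: "outs ?c t = map Elem ws @ [Output]" using ws by (simp add: outs_silent frame_generate)
    have "outputs (map Elem ws @ Output # tr) = ?T # outputs tr" for tr
      by (simp add: outputs_def outputs_emit ws)
    moreover have "outputs [] = []" by (simp add: outputs_def)
    ultimately show "?J (insert ?T X) (es @ outs ?c t) (eff ?c t)"
      unfolding o using J by (simp add: snd_eff notin_generate frame_emit)
  next
    show "?J {} [] u" using eu 7 by (simp add: outputs_def)
    show "wregs ?c \<subseteq> {..<12}" using wregs_generate_bound[of k] by (simp add: frame_emit)
  qed (auto simp: frame_all notin_all)
  then show ?thesis
    by (simp add: list_neighbors_def outs_silent frame_prepare t_def u_def)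
qed

definition searching :: "nat set list \<Rightarrow> nat \<Rightarrow> state \<Rightarrow> bool" where
  "searching Q h s \<longleftrightarrow> envs s \<and> queues Q s \<and> fst s 10 = h \<and> h \<le> length Q"

lemma start_correct:
  assumes i: "input s" and z: "fst s = (\<lambda>_. 0)" "snd s 8 = (\<lambda>_. 0)"
  shows "searching [completion {}] 0 (eff (start k) s)" "outs (start k) s = []"
proof -
  let ?t = "eff (prepare ;; greedy k) s"
  note t = greedy_empty[OF i]
  have "queues [] ?t" using t(3)[of 9] t(4)[of 8] z by (simp add: queue_def)
  from visit_correct[OF t(1,2) completion_empty_Sol this]
  have "queues [completion {}] (eff visit ?t)" by simp
  moreover have "envs (eff visit ?t)" using t(1) by (simp add: snd_eff frame_visit)
  moreover have "fst (eff visit ?t) 10 = 0" using t(3)[of 10] z by (simp add: fst_eff frame_visit)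
  ultimately show "searching [completion {}] 0 (eff (start k) s)"
    by (simp add: searching_def start_def)
  show "outs (start k) s = []" by (rule outs_silent) (simp add: start_def frame_all)
qed

lemma process_correct:
  assumes s: "searching Q h s" and h: "h < length Q"
  obtains R ws where "searching (Q @ R) (Suc h) (eff (process k) s)" "nbrs (Q ! h) \<subseteq> set (Q @ R)"
    "outs (process k) s = map Elem ws @ [Output]" "set ws = Q ! h"
proof -
  let ?S = "Q ! h" and ?c = "generate k ;; visit"
  have e: "envs s" and q: "queues Q s" "fst s 10 = h" using s by (auto simp: searching_def)
  have S: "?S \<in> Sol" using q h by (auto simp: queue_def)
  let ?t = "eff decode s"
  note t = decode_correct[OF e q h]
  have et: "envs ?t" using e by (simp add: snd_eff frame_decode)
  obtain ws where ws: "outs (emit 7) ?t = map Elem ws @ [Output]" "set ws = ?S"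
    using emit_correct[OF et t(1) Sol_subset[OF S]] .
  let ?u = "eff (emit 7) ?t"
  let ?J = "\<lambda>X (es :: event list) t. envs t \<and> chr n (snd t 7) ?S \<and> es = [] \<and> fst t 10 = Suc h \<and>
    (\<exists>R. queues (Q @ R) t \<and> set (Q @ R) = set Q \<union> X)"
  have u: "?J {} [] ?u"
    using et t q by (auto simp: snd_eff fst_eff frame_emit frame_decode intro!: exI[of _ "[]"])
  have "?J ({} \<union> nbrs ?S) ([] @ outs (candidates k ?c) ?u) (eff (candidates k ?c) ?u)"
  proof (rule candidates_invariant)
    fix X and es :: "event list" and t :: state
    assume J: "?J X es t" and v: "fst t 7 < n"
    let ?t = "eff (generate k) t" and ?T = "cand ?S (fst t 7) (\<lambda>i. fst t (12 + i))"
    have T: "chr n (snd ?t 4) ?T" by (rule generate_correct) (use J S v in auto)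
    have et: "envs ?t" using J by (simp add: snd_eff notin_generate)
    obtain R where R: "queues (Q @ R) t" "set (Q @ R) = set Q \<union> X" using J by blast
    then have "queues (Q @ R) ?t" by (simp add: fst_eff snd_eff notin_generate)
    note V = visit_correct[OF et T cand_Sol[OF S v] this]
    have "\<exists>R. queues (Q @ R) (eff visit ?t) \<and> set (Q @ R) = set Q \<union> insert ?T X"
    proof (cases "?T \<in> set (Q @ R)")
      case True
      then have "queues (Q @ R) (eff visit ?t)" using V by (simp only: if_True)
      then show ?thesis using True R(2) by (intro exI[of _ R]) auto
    next
      case False
      then have "queues (Q @ R @ [?T]) (eff visit ?t)" using V by (simp only: if_False append_assoc)
      then show ?thesis using R(2) by (intro exI[of _ "R @ [?T]"]) auto
    qed
    moreover have "outs ?c t = []" by (rule outs_silent) (simp add: frame_all)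
    ultimately show "?J (insert ?T X) (es @ outs ?c t) (eff ?c t)"
      using J by (simp add: fst_eff snd_eff notin_generate frame_visit)
  next
    show "?J {} [] ?u" by (rule u)
    show "wregs ?c \<subseteq> {..<12}" using wregs_generate_bound[of k] by (simp add: frame_visit)
  qed (auto simp: frame_all notin_all)
  then obtain R where R: "queues (Q @ R) (eff (process k) s)" "set (Q @ R) = set Q \<union> nbrs ?S"
    "envs (eff (process k) s)" "fst (eff (process k) s) 10 = Suc h"
    by (auto simp: process_def)
  have "outs (candidates k ?c) ?u = []"
    by (rule outs_silent) (simp add: silent_candidates frame_all)
  then have "outs (process k) s = map Elem ws @ [Output]"
    using ws by (simp add: process_def outs_silent frame_decode)
  with R ws(2) h show ?thesis by (intro that[of R ws]) (auto simp: searching_def)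
qed

text \<open>Induction on \<open>card Sol - h\<close>, which decreases because the queue consists of
  distinct solutions. Quantifying over the time \<open>b \<le> D\<close> already spent makes it
  composable: a round takes at most \<open>D\<close>, so a period closed in it is at most
  \<open>2 * D\<close>, and as it contains an output the time carried on is again at most
  \<open>D\<close>.\<close>

lemma search_loop:
  assumes "searching Q h s" "snd s 0 = a" "time a (process k) + 3 \<le> D"
    "\<And>i. i < h \<Longrightarrow> nbrs (Q ! i) \<subseteq> set Q"
  shows "\<exists>tr s' R. exec (While (Less (Reg 10) (Reg 9)) (compile (process k))) s tr s' \<and>
    outputs tr = drop h (Q @ R) \<and> distinct (Q @ R) \<and> set (Q @ R) \<subseteq> Sol \<and>
    (\<forall>S\<in>set (Q @ R). nbrs S \<subseteq> set (Q @ R)) \<and>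
    (\<forall>b\<le>D. \<forall>g\<in>set (gaps_from b tr). g \<le> 2 * D)"
  using assms
proof (induction "card Sol - h" arbitrary: Q h s rule: less_induct)
  case less
  let ?b = "Less (Reg 10) (Reg 9)" and ?c = "compile (process k)"
  have q: "queues Q s" "fst s 10 = h" "h \<le> length Q" using less.prems by (auto simp: searching_def)
  then have b: "bval ?b s \<longleftrightarrow> h < length Q" by (simp add: queue_def)
  show ?case
  proof (cases "h < length Q")
    case False
    then have "h = length Q" using q by simp
    have "exec (While ?b ?c) s (steps 3) s"
      using exec.WhileFalse[of ?b s ?c] b False by (simp add: numeral_eq_Suc)
    moreover have "g \<le> 2 * D" if "c \<le> D" "g \<in> set (gaps_from c (steps 3))" for c g
      using gaps_from_le[OF that(2)] that(1) less.prems(3) by simp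
    moreover have "outputs (steps 3) = []" by (simp add: outputs_def numeral_eq_Suc)
    moreover have "\<forall>S\<in>set Q. nbrs S \<subseteq> set Q"
      using less.prems(4) \<open>h = length Q\<close> by (metis in_set_conv_nth)
    ultimately show ?thesis
      using q \<open>h = length Q\<close>
      by (intro exI[of _ "steps 3"] exI[of _ s] exI[of _ "[]"]) (auto simp: queue_def)
  next
    case True
    obtain R ws where R: "searching (Q @ R) (Suc h) (eff (process k) s)"
      "nbrs (Q ! h) \<subseteq> set (Q @ R)" "outs (process k) s = map Elem ws @ [Output]" "set ws = Q ! h"
      using process_correct[OF less.prems(1) True] .
    obtain tr1 where tr1: "exec ?c s tr1 (eff (process k) s)" "length tr1 \<le> time a (process k)"
      "nonstep tr1 = outs (process k) s"
      using exec_compile[OF wf_programs(4)] less.prems(2) by blast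
    have out1: "outputs_from {} (tr1 @ tr) = (Q ! h) # outputs_from {} tr" for tr
    proof -
      have "nonstep (tr1 @ tr) = map Elem ws @ Output # nonstep tr" using tr1(3) R(3) by simp
      then show ?thesis
        by (metis outputs_nonstep outputs_emit R(4) sup_bot_left)
    qed
    have hc: "h < card Sol"
    proof -
      have "length Q = card (set Q)" "set Q \<subseteq> Sol" using q by (auto simp: queue_def distinct_card)
      then show ?thesis using True card_mono[OF finite_Sol, of "set Q"] by linarith
    qed
    have "\<exists>tr s' R'. exec (While ?b ?c) (eff (process k) s) tr s' \<and>
      outputs tr = drop (Suc h) ((Q @ R) @ R') \<and> distinct ((Q @ R) @ R') \<and> set ((Q @ R) @ R') \<subseteq> Sol \<and>
      (\<forall>S\<in>set ((Q @ R) @ R'). nbrs S \<subseteq> set ((Q @ R) @ R')) \<and>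
      (\<forall>b\<le>D. \<forall>g\<in>set (gaps_from b tr). g \<le> 2 * D)"
    proof (rule less.hyps)
      show "card Sol - Suc h < card Sol - h" using hc by simp
      show "searching (Q @ R) (Suc h) (eff (process k) s)" by (rule R)
      show "snd (eff (process k) s) 0 = a" using less.prems(2) by (simp add: eff_input wf_programs)
      show "time a (process k) + 3 \<le> D" by (rule less.prems)
      fix i assume i: "i < Suc h"
      show "nbrs ((Q @ R) ! i) \<subseteq> set (Q @ R)"
      proof (cases "i = h")
        case False
        then show ?thesis using i True less.prems(4)[of i] by (auto simp: nth_append)
      qed (use R(2) True in \<open>auto simp: nth_append\<close>)
    qed
    then obtain tr s' R' where IH: "exec (While ?b ?c) (eff (process k) s) tr s'"
      "outputs tr = drop (Suc h) ((Q @ R) @ R')" "distinct ((Q @ R) @ R')" "set ((Q @ R) @ R') \<subseteq> Sol"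
      "\<forall>S\<in>set ((Q @ R) @ R'). nbrs S \<subseteq> set ((Q @ R) @ R')"
      "\<And>b g. b \<le> D \<Longrightarrow> g \<in> set (gaps_from b tr) \<Longrightarrow> g \<le> 2 * D" by blast
    let ?blk = "steps 3 @ tr1"
    have "exec (While ?b ?c) s (?blk @ tr) s'"
      using exec.WhileTrue[of ?b s ?c tr1 _ tr s'] b True tr1(1) IH(1) by (simp add: numeral_eq_Suc)
    moreover have "outputs (?blk @ tr) = drop h (Q @ R @ R')"
    proof -
      have "outputs (?blk @ tr) = outputs_from {} (tr1 @ tr)" by (simp add: outputs_def numeral_eq_Suc)
      then show ?thesis
        using IH(2) True Cons_nth_drop_Suc[of h "Q @ R @ R'"] by (simp add: out1 outputs_def nth_append)
    qed
    moreover have "g \<le> 2 * D" if "c \<le> D" "g \<in> set (gaps_from c (?blk @ tr))" for c g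
    proof -
      have len: "length ?blk \<le> D" using tr1(2) less.prems(3) by simp
      have "outputs_from {} ?blk \<noteq> []" using out1[of "[]"] by (simp add: numeral_eq_Suc)
      then have last: "last (gaps_from c ?blk) \<le> D" using last_gap_le len le_trans by blast
      from that(2) consider "g \<in> set (butlast (gaps_from c ?blk))"
        | "g \<in> set (gaps_from (last (gaps_from c ?blk)) tr)"
        unfolding gaps_from_append[of c ?blk] by auto
      then show ?thesis
      proof cases
        case 1
        then have "g \<le> c + length ?blk" by (meson gaps_from_le in_set_butlastD)
        then show ?thesis using len that(1) by linarith
      next
        case 2
        then show ?thesis using IH(6) last by blast
      qed
    qed
    ultimately show ?thesis
      using IH(3-5) by (intro exI[of _ "?blk @ tr"] exI[of _ s'] exI[of _ "R @ R'"]) auto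
  qed
qed

lemma enumerate_all_correct:
  assumes i: "input s" and z: "fst s = (\<lambda>_. 0)" "snd s 8 = (\<lambda>_. 0)"
    and D: "time (snd s 0) (start k) \<le> D" "time (snd s 0) (process k) + 3 \<le> D"
  shows "\<exists>tr s'. exec (enumerate_all k) s tr s' \<and> distinct (outputs tr) \<and>
    set (outputs tr) = Sol \<and> delay tr \<le> 2 * D"
proof -
  let ?w = "While (Less (Reg 10) (Reg 9)) (compile (process k))"
  note st = start_correct[OF i z]
  obtain tr1 where tr1: "exec (compile (start k)) s tr1 (eff (start k) s)"
    "length tr1 \<le> time (snd s 0) (start k)" "nonstep tr1 = []"
    using exec_compile[OF wf_programs(3)] st(2) by metis
  have "\<exists>tr s' R. exec ?w (eff (start k) s) tr s' \<and>
    outputs tr = drop 0 ([completion {}] @ R) \<and> distinct ([completion {}] @ R) \<and>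
    set ([completion {}] @ R) \<subseteq> Sol \<and>
    (\<forall>S\<in>set ([completion {}] @ R). nbrs S \<subseteq> set ([completion {}] @ R)) \<and>
    (\<forall>b\<le>D. \<forall>g\<in>set (gaps_from b tr). g \<le> 2 * D)"
    by (rule search_loop[OF st(1) _ D(2)]) (auto simp: eff_input wf_programs)
  then obtain tr s' R where R: "exec ?w (eff (start k) s) tr s'" "outputs tr = [completion {}] @ R"
    "distinct ([completion {}] @ R)" "set ([completion {}] @ R) \<subseteq> Sol"
    "\<forall>S\<in>set ([completion {}] @ R). nbrs S \<subseteq> set ([completion {}] @ R)"
    "\<And>b g. b \<le> D \<Longrightarrow> g \<in> set (gaps_from b tr) \<Longrightarrow> g \<le> 2 * D" by auto
  have "exec (enumerate_all k) s (tr1 @ tr) s'"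
    unfolding enumerate_all_def using tr1(1) R(1) by (rule exec.Seq)
  moreover have "outputs (tr1 @ tr) = outputs tr"
    unfolding outputs_def using tr1(3) by (metis append_Nil filter_append outputs_nonstep)
  moreover have "set (outputs tr) = Sol"
    unfolding R(2) by (rule reachable) (use R(4,5) in auto)
  moreover have "delay (tr1 @ tr) \<le> 2 * D"
  proof -
    \<comment> \<open>The start phase outputs nothing, so its whole length, at most
      \<open>D\<close>, becomes the initial value for the gaps of the search.\<close>
    have "gaps_from b tr = [b + length tr]" if "nonstep tr = []" for b tr
      using that by (induction tr arbitrary: b) (auto split: if_splits)
    then have "gaps_from 0 (tr1 @ tr) = gaps_from (length tr1) tr"
      using tr1(3) by (simp add: gaps_from_append)
    moreover have "length tr1 \<le> D" using tr1(2) D(1) by simp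
    ultimately show ?thesis
      unfolding delay_def using R(6) gaps_from_nonempty by (subst Max_le_iff) auto
  qed
  ultimately show ?thesis
    using R(2,3) by (intro exI[of _ "tr1 @ tr"] exI[of _ s']) simp
qed

end

section \<open>The theorem\<close>

lemma nth_concat_pairs:
  "i < length es \<Longrightarrow> concat (map (\<lambda>(u, v). [u, v]) es) ! (i + i) = fst (es ! i) \<and>
    concat (map (\<lambda>(u, v). [u, v]) es) ! Suc (i + i) = snd (es ! i)"
proof (induction es arbitrary: i)
  case (Cons e es)
  then show ?case by (cases i; cases e) auto
qed simp

lemma length_concat_pairs: "length (concat (map (\<lambda>(u, v). [u, v]) es)) = length es + length es"
  by (induction es) auto

lemma load_graph:
  fixes yss :: "nat list list"
  assumes G: "graph_code G xs" and yss: "length yss \<le> 1"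
  defines "n \<equiv> card (fst G)" and "s \<equiv> load (xs # yss)"
  shows "vgraph n (snd G)" "fst G = {..<n}" "snd s 0 0 = n" "snd s 0 1 = card (snd G)"
    and "(\<lambda>i. {snd s 0 (i + i + 2), snd s 0 (i + i + 3)}) ` {..<snd s 0 1} = snd G"
    and "fst s = (\<lambda>_. 0)" "2 \<le> A \<Longrightarrow> snd s A = (\<lambda>_. 0)"
proof -
  obtain es where es: "length es = card (snd G)" "(\<lambda>(u, v). {u, v}) ` set es = snd G"
    "xs = n # card (snd G) # concat (map (\<lambda>(u, v). [u, v]) es)"
    using G by (auto simp: graph_code_def n_def)
  show V: "fst G = {..<n}" using G by (auto simp: graph_code_def n_def)
  show "vgraph n (snd G)"
    using G V by unfold_locales (auto simp: graph_code_def simple_graph_def)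
  show "snd s 0 0 = n" by (simp add: s_def load_def es)
  show m: "snd s 0 1 = card (snd G)" by (simp add: s_def load_def es)
  have "{snd s 0 (i + i + 2), snd s 0 (i + i + 3)} = (\<lambda>(u, v). {u, v}) (es ! i)"
    if "i < card (snd G)" for i
    using that nth_concat_pairs[of i es]
    by (simp add: s_def load_def es(1,3) length_concat_pairs eval_nat_numeral split: prod.split)
  then have "(\<lambda>i. {snd s 0 (i + i + 2), snd s 0 (i + i + 3)}) ` {..<snd s 0 1} =
      (\<lambda>i. (\<lambda>(u, v). {u, v}) (es ! i)) ` {..<length es}"
    unfolding m es(1) by (intro image_cong) auto
  also have "\<dots> = (\<lambda>(u, v). {u, v}) ` set es"
    by (simp add: set_conv_nth image_image[symmetric] lessThan_def) (auto simp: image_def)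
  finally show "(\<lambda>i. {snd s 0 (i + i + 2), snd s 0 (i + i + 3)}) ` {..<snd s 0 1} = snd G"
    using es(2) by simp
  show "fst s = (\<lambda>_. 0)" by (simp add: s_def load_def)
  show "2 \<le> A \<Longrightarrow> snd s A = (\<lambda>_. 0)" using yss by (auto simp: s_def load_def)
qed

text \<open>Turns a bound in vertices and edges into a polynomial in the size of the universe
  alone.\<close>

lemma (in vgraph) card_E: "card E \<le> n ^ 2"
proof -
  have "E \<subseteq> (\<lambda>(u, v). {u, v}) ` ({..<n} \<times> {..<n})"
    using edge by (fastforce simp: card_2_iff image_iff)
  then have "card E \<le> card ({..<n} \<times> {..<n})"
    by (meson card_image_le card_mono finite_SigmaI finite_imageI finite_lessThan le_trans)
  then show ?thesis by (simp add: power2_eq_square)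
qed

lemma ord_polynomial:
  assumes "ord p 1 j"
  obtains q :: "nat poly" where "\<And>f. f 1 \<le> f 0 ^ 2 \<Longrightarrow> time f p \<le> poly q (f 0)"
proof -
  obtain C where C: "time f p \<le> C * ((f 1 + 1) ^ 1 * (f 0 + 1) ^ j)" for f
    using assms ord_def by auto
  show ?thesis
  proof (rule that)
    fix f :: "nat \<Rightarrow> nat" assume "f 1 \<le> f 0 ^ 2"
    then have "C * ((f 1 + 1) ^ 1 * (f 0 + 1) ^ j) \<le> C * ((f 0 ^ 2 + 1) * (f 0 + 1) ^ j)" by simp
    from le_trans[OF C[of f] this]
    have "time f p \<le> C * ((f 0 ^ 2 + 1) * (f 0 + 1) ^ j)" .
    also have "\<dots> = poly (smult C ((monom 1 2 + 1) * [:1, 1:] ^ j)) (f 0)"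
      by (simp add: poly_monom)
    finally show "time f p \<le> poly (smult C ((monom 1 2 + 1) * [:1, 1:] ^ j)) (f 0)" .
  qed
qed

text \<open>For positive counts each successor is at most twice the number, which costs the factor
  \<open>2 ^ Suc j\<close>. Without edges the product on the right would be 0.\<close>

lemma ord_delay:
  assumes "ord p 1 j"
  obtains c where "\<And>f. 0 < f 1 \<Longrightarrow> 0 < f 0 \<Longrightarrow> time f p \<le> c * (f 1 * f 0 ^ j)"
proof -
  obtain C where C: "time f p \<le> C * ((f 1 + 1) ^ 1 * (f 0 + 1) ^ j)" for f
    using assms ord_def by auto
  show ?thesis
  proof (rule that)
    fix f :: "nat \<Rightarrow> nat" assume f: "0 < f 1" "0 < f 0"
    have "(f 0 + 1) ^ j \<le> (2 * f 0) ^ j" using f by (intro power_mono) auto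
    then have "(f 1 + 1) * (f 0 + 1) ^ j \<le> (2 * f 1) * (2 * f 0) ^ j"
      using f by (intro mult_mono) auto
    also have "\<dots> = 2 ^ Suc j * (f 1 * f 0 ^ j)" by (simp add: power_mult_distrib)
    finally have "C * ((f 1 + 1) ^ 1 * (f 0 + 1) ^ j) \<le> C * (2 ^ Suc j * (f 1 * f 0 ^ j))" by simp
    from le_trans[OF C[of f] this]
    show "time f p \<le> (C * 2 ^ Suc j) * (f 1 * f 0 ^ j)" by (simp only: mult.assoc)
  qed
qed

lemma maximal_degenerate_code:
  "graph_code G xs \<Longrightarrow> maximal_degenerate k G = vgraph.Sol (card (fst G)) (snd G) k"
  by (intro maximal_degenerate_eq) (auto simp: graph_code_def)

theorem theorem6p2:
  fixes k :: nat
  shows "proximity_searchable graph_code fst (maximal_degenerate k) \<and>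
    (\<exists>(P :: com) (c :: nat). \<forall>G xs. graph_code G xs \<longrightarrow>
      (\<exists>tr s. exec P (load [xs]) tr s \<and>
        distinct (outputs tr) \<and> set (outputs tr) = maximal_degenerate k G \<and>
        (snd G \<noteq> {} \<longrightarrow> delay tr \<le> c * (card (snd G) * card (fst G) ^ (k + 2)))))"
proof
  show "proximity_searchable graph_code fst (maximal_degenerate k)"
    unfolding proximity_searchable_def
  proof (intro exI[of _ "\<lambda>G. vgraph.cap (snd G) k"]
      exI[of _ "\<lambda>G. vgraph.nbrs (card (fst G)) (snd G) k"] conjI allI impI)
    fix G xs assume code: "graph_code G xs"
    interpret vgraph "card (fst G)" "snd G" k using load_graph(1)[OF code, of "[]"] by simp
    show "\<forall>S\<in>maximal_degenerate k G. \<forall>S'\<in>maximal_degenerate k G.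
        vgraph.cap (snd G) k S S' \<subseteq> fst G"
      using cap_subset load_graph(2)[OF code, of "[]"] unfolding maximal_degenerate_code[OF code] by simp
    show "\<forall>S\<in>maximal_degenerate k G.
        vgraph.nbrs (card (fst G)) (snd G) k S \<subseteq> maximal_degenerate k G"
      using nbrs_Sol unfolding maximal_degenerate_code[OF code] by blast
    show "\<forall>S\<in>maximal_degenerate k G. \<forall>S'\<in>maximal_degenerate k G. S \<noteq> S' \<longrightarrow>
        (\<exists>T\<in>vgraph.nbrs (card (fst G)) (snd G) k S.
          card (vgraph.cap (snd G) k S S') < card (vgraph.cap (snd G) k T S'))"
      using proximity unfolding maximal_degenerate_code[OF code] by blast
  next
    obtain q where q: "\<And>f. f 1 \<le> f 0 ^ 2 \<Longrightarrow> time f (first_solution k) \<le> poly q (f 0)"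
      using ord_polynomial[OF ord_programs(1)] by blast
    show "\<exists>P p. \<forall>G xs. graph_code G xs \<longrightarrow> (\<exists>tr s. exec P (load [xs]) tr s \<and>
        length tr \<le> poly p (card (fst G)) \<and> (\<exists>S\<in>maximal_degenerate k G. outputs tr = [S]))"
    proof (intro exI[of _ "compile (first_solution k)"] exI[of _ q] allI impI)
      fix G xs assume code: "graph_code G xs"
      note l = load_graph[OF code, of "[]", simplified]
      interpret vgraph "card (fst G)" "snd G" k using l(1) by simp
      obtain tr where tr: "exec (compile (first_solution k)) (load [xs]) tr (eff (first_solution k) (load [xs]))"
        "length tr \<le> time (snd (load [xs]) 0) (first_solution k)"
        "nonstep tr = outs (first_solution k) (load [xs])"
        using exec_compile[OF wf_programs(1)] by blast
      have "length tr \<le> poly q (card (fst G))"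
        using tr(2) q[of "snd (load [xs]) 0"] l card_E by simp
      moreover have "outputs tr = [completion {}]"
        using outputs_nonstep_eq[OF tr(3)] first_solution_outputs l by simp
      ultimately show "\<exists>tr s. exec (compile (first_solution k)) (load [xs]) tr s \<and>
          length tr \<le> poly q (card (fst G)) \<and> (\<exists>S\<in>maximal_degenerate k G. outputs tr = [S])"
        using tr(1) completion_empty_Sol maximal_degenerate_code[OF code] by blast
    qed
  next
    obtain q where q: "\<And>f. f 1 \<le> f 0 ^ 2 \<Longrightarrow> time f (list_neighbors k) \<le> poly q (f 0)"
      using ord_polynomial[OF ord_programs(2)] by blast
    show "\<exists>P p. \<forall>G xs S ys. graph_code G xs \<and> S \<in> maximal_degenerate k G \<and> set_code S ys \<longrightarrow>
        (\<exists>tr s. exec P (load [xs, ys]) tr s \<and> length tr \<le> poly p (card (fst G)) \<and>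
          set (outputs tr) = vgraph.nbrs (card (fst G)) (snd G) k S)"
    proof (intro exI[of _ "compile (list_neighbors k)"] exI[of _ q] allI impI, elim conjE)
      fix G xs S ys
      assume code: "graph_code G xs" and S: "S \<in> maximal_degenerate k G" and ys: "set_code S ys"
      let ?s = "load [xs, ys]"
      note l = load_graph[OF code, of "[ys]", simplified]
      interpret vgraph "card (fst G)" "snd G" k using l(1) by simp
      obtain vs where vs: "distinct vs" "set vs = S" "ys = length vs # vs"
        using ys by (auto simp: set_code_def)
      obtain tr where tr: "exec (compile (list_neighbors k)) ?s tr (eff (list_neighbors k) ?s)"
        "length tr \<le> time (snd ?s 0) (list_neighbors k)"
        "nonstep tr = outs (list_neighbors k) ?s"
        using exec_compile[OF wf_programs(2)] by blast
      have "length tr \<le> poly q (card (fst G))"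
        using tr(2) q[of "snd ?s 0"] l card_E by simp
      moreover have "set (outputs (outs (list_neighbors k) ?s)) = nbrs S"
      proof (rule list_neighbors_outputs)
        show "snd ?s 1 0 = length vs" "\<And>i. i < length vs \<Longrightarrow> snd ?s 1 (Suc i) = vs ! i"
          by (simp_all add: load_def vs(3))
      qed (use l S vs maximal_degenerate_code[OF code] in auto)
      ultimately show "\<exists>tr s. exec (compile (list_neighbors k)) ?s tr s \<and>
          length tr \<le> poly q (card (fst G)) \<and> set (outputs tr) = nbrs S"
        using tr(1) outputs_nonstep_eq[OF tr(3)] by metis
    qed
  qed
next
  obtain c1 where c1: "\<And>f. 0 < f 1 \<Longrightarrow> 0 < f 0 \<Longrightarrow> time f (start k) \<le> c1 * (f 1 * f 0 ^ (k + 2))"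
    using ord_delay[OF ord_programs(3)] by blast
  obtain c2 where c2: "\<And>f. 0 < f 1 \<Longrightarrow> 0 < f 0 \<Longrightarrow> time f (process k) \<le> c2 * (f 1 * f 0 ^ (k + 2))"
    using ord_delay[OF ord_programs(4)] by blast
  show "\<exists>P c. \<forall>G xs. graph_code G xs \<longrightarrow>
      (\<exists>tr s. exec P (load [xs]) tr s \<and>
        distinct (outputs tr) \<and> set (outputs tr) = maximal_degenerate k G \<and>
        (snd G \<noteq> {} \<longrightarrow> delay tr \<le> c * (card (snd G) * card (fst G) ^ (k + 2))))"
  proof (intro exI[of _ "enumerate_all k"] exI[of _ "2 * (c1 + c2 + 3)"] allI impI)
    fix G xs assume code: "graph_code G xs"
    let ?s = "load [xs]"
    let ?B = "card (snd G) * card (fst G) ^ (k + 2)"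
    note l = load_graph[OF code, of "[]", simplified]
    interpret vgraph "card (fst G)" "snd G" k using l(1) by simp
    \<comment> \<open>The 3 pays for one test of the search loop. It is absorbed below since
      \<open>1 \<le> ?B\<close> as soon as there is an edge.\<close>
    define D where "D = time (snd ?s 0) (start k) + time (snd ?s 0) (process k) + 3"
    obtain tr s' where tr: "exec (enumerate_all k) ?s tr s'" "distinct (outputs tr)"
      "set (outputs tr) = Sol" "delay tr \<le> 2 * D"
      using enumerate_all_correct[of ?s D] l by (auto simp: D_def)
    have "delay tr \<le> 2 * (c1 + c2 + 3) * ?B" if ne: "snd G \<noteq> {}"
    proof -
      have fin: "finite (snd G)" using code
        unfolding graph_code_def by (metis finite_imageI finite_set)
      have m: "0 < card (snd G)" using ne fin by (simp add: card_gt_0_iff)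
      obtain e where "e \<in> snd G" using ne by blast
      then have n: "0 < card (fst G)" using edge[of e] by (cases "card (fst G)") auto
      have "1 \<le> ?B" using m n by (simp add: Suc_leI)
      moreover have "time (snd ?s 0) (start k) \<le> c1 * ?B" "time (snd ?s 0) (process k) \<le> c2 * ?B"
        using c1[of "snd ?s 0"] c2[of "snd ?s 0"] l m n by simp_all
      ultimately have "D \<le> (c1 + c2 + 3) * ?B" unfolding D_def add_mult_distrib by linarith
      then have "2 * D \<le> 2 * ((c1 + c2 + 3) * ?B)" by (rule mult_le_mono2)
      with tr(4) show ?thesis unfolding mult.assoc by (rule le_trans)
    qed
    then show "\<exists>tr s. exec (enumerate_all k) ?s tr s \<and>
        distinct (outputs tr) \<and> set (outputs tr) = maximal_degenerate k G \<and>
        (snd G \<noteq> {} \<longrightarrow> delay tr \<le> 2 * (c1 + c2 + 3) * ?B)"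
      using tr maximal_degenerate_code[OF code] by blast
  qed
qed

end
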